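(* If $u$ is a positive integer and $G$ is a finite soluble group, then $\Delta_u(G)$ is connected.
   Context: Let $G$ be a finite group and $u$ a positive integer. A generating set $X$ of $G$ is minimal if no proper subset of $X$ generates $G$. $\Gamma_u(G)$ is the simple graph whose vertices are the elements of $G$ and in which two distinct vertices $x,y$ are joined by an edge if and only if there exists a minimal generating set of $G$ of cardinality exactly $u$ containing both $x$ and $y$. $V_u(G)$ denotes the set of non-isolated vertices of $\Gamma_u(G)$, and $\Delta_u(G)$ is the subgraph of $\Gamma_u(G)$ induced by $V_u(G)$. "Connected" means that any two vertices are joined by a path; the graph with empty vertex set is regarded as connected. *)

theory Defs
  imports "HOL-Algebra.Solvable_Groups" "Graph_Theory.Digraph_Component"
begin

definition generates :: "('a, 'b) monoid_scheme \<Rightarrow> 'a set \<Rightarrow> bool" where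
  "generates G X \<longleftrightarrow> X \<subseteq> carrier G \<and> generate G X = carrier G"

definition minimal_generating_set :: "('a, 'b) monoid_scheme \<Rightarrow> 'a set \<Rightarrow> bool" where
  "minimal_generating_set G X \<longleftrightarrow> generates G X \<and> (\<forall>Y. Y \<subset> X \<longrightarrow> \<not> generates G Y)"

text \<open>As usual in the library, an undirected simple graph is a loop-free symmetric digraph.\<close>

definition gen_Gamma :: "nat \<Rightarrow> ('a, 'b) monoid_scheme \<Rightarrow> 'a pair_pre_digraph" where
  "gen_Gamma u G =
    \<lparr> pverts = carrier G,
      parcs = {(x, y). x \<in> carrier G \<and> y \<in> carrier G \<and> x \<noteq> y \<and>
                 (\<exists>X. minimal_generating_set G X \<and> card X = u \<and> x \<in> X \<and> y \<in> X)} \<rparr>"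

definition nonisolated :: "('a, 'c) pre_digraph \<Rightarrow> 'a set" where
  "nonisolated D = {x \<in> verts D. \<exists>y \<in> verts D. x \<rightarrow>\<^bsub>D\<^esub> y}"

definition gen_Delta :: "nat \<Rightarrow> ('a, 'b) monoid_scheme \<Rightarrow> ('a, 'a \<times> 'a) pre_digraph" where
  "gen_Delta u G = with_proj (gen_Gamma u G) \<restriction> nonisolated (with_proj (gen_Gamma u G))"

text \<open>The library's notion of connectedness excludes the graph without vertices; here that
  graph counts as connected.\<close>

definition connected_or_null :: "('a, 'c) pre_digraph \<Rightarrow> bool" where
  "connected_or_null D \<longleftrightarrow> verts D = {} \<or> Digraph_Component.connected D"

lemma graph_gen_Gamma:
  assumes "finite (carrier G)"
  shows "graph (with_proj (gen_Gamma u G))"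
proof -
  have "parcs (gen_Gamma u G) \<subseteq> carrier G \<times> carrier G"
    by (auto simp: gen_Gamma_def)
  then have "finite (parcs (gen_Gamma u G))"
    using assms finite_subset by blast
  then show ?thesis
    using assms
    by unfold_locales (auto simp: gen_Gamma_def arc_to_ends_def symmetric_def arcs_ends_def sym_def image_iff)
qed

end

theory Submission
  imports Defs
begin

text \<open>
  The graph is connected when any two minimal generating sets of size \<open>u\<close> can be joined by a chain in
  which consecutive sets meet. This is proved by descent along a chief series. Rather than passing
  to quotients, generation is considered modulo a normal subgroup \<open>L\<close>; let \<open>N / L\<close> be an abelian
  chief factor.

  A minimal generating set modulo \<open>L\<close> of size \<open>u\<close> either is already one modulo \<open>N\<close>, or is
  \<open>insert x X0\<close> with \<open>X0\<close> minimal modulo \<open>N\<close> and generating a complement of \<open>N / L\<close>. In the second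
  case \<open>x\<close> can be exchanged for any element of \<open>N - L\<close>, so all sets of the second kind are linked.

  For the sets of the first kind, chains modulo \<open>N\<close> are lifted. By Gaschuetz's counting argument,
  whether a partial lift extends to a generating one depends only on the number of complements
  containing it, so two sets that meet modulo \<open>N\<close> have generating lifts that meet. The lifts of a
  fixed set that fail to generate are closed under \<open>f g\<^sup>-\<^sup>1 h\<close>, which for \<open>u \<ge> 3\<close> links the generating
  lifts of that set; for \<open>u = 2\<close> one also needs the move \<open>(p, c) \<mapsto> (p, p c)\<close>.
\<close>

section \<open>Generation modulo a normal subgroup\<close>

definition gen_mod :: "('a, 'b) monoid_scheme \<Rightarrow> 'a set \<Rightarrow> 'a set \<Rightarrow> bool" where
  "gen_mod G L X \<longleftrightarrow> X \<subseteq> carrier G \<and> generate G (X \<union> L) = carrier G"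

text \<open>For normal \<open>L\<close> distinct members lie in distinct cosets of \<open>L\<close>
  (\<open>min_gen_mod_inj\<close>), so \<open>u\<close> is also the size of the image in
  \<open>G / L\<close>.\<close>

definition min_gen_mod :: "('a, 'b) monoid_scheme \<Rightarrow> 'a set \<Rightarrow> nat \<Rightarrow> 'a set set" where
  "min_gen_mod G L u = {X. gen_mod G L X \<and> card X = u \<and> (\<forall>Y. Y \<subset> X \<longrightarrow> \<not> gen_mod G L Y)}"

text \<open>Elements congruent modulo \<open>L\<close> are linked because they stand for one element of \<open>G / L\<close>.\<close>

definition link :: "('a, 'b) monoid_scheme \<Rightarrow> 'a set \<Rightarrow> nat \<Rightarrow> 'a rel" where
  "link G L u = {(x, y). (\<exists>X\<in>min_gen_mod G L u. x \<in> X \<and> y \<in> X) \<or>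
     (x \<in> carrier G \<and> y \<in> carrier G \<and> L #>\<^bsub>G\<^esub> x = L #>\<^bsub>G\<^esub> y)}"

lemma gen_modD: "gen_mod G L X \<Longrightarrow> X \<subseteq> carrier G"
  by (simp add: gen_mod_def)

lemma min_gen_modD:
  assumes "X \<in> min_gen_mod G L u"
  shows "gen_mod G L X" "X \<subseteq> carrier G" "card X = u" "Y \<subset> X \<Longrightarrow> \<not> gen_mod G L Y"
  using assms by (auto simp: min_gen_mod_def gen_mod_def)

lemma sym_link: "sym (link G L u)"
  by (auto simp: link_def sym_def)

lemma link_rtrancl_sym: "(x, y) \<in> (link G L u)\<^sup>* \<Longrightarrow> (y, x) \<in> (link G L u)\<^sup>*"
  by (meson sym_link sym_rtrancl symD)

lemma min_gen_mod_link:
  "X \<in> min_gen_mod G L u \<Longrightarrow> x \<in> X \<Longrightarrow> y \<in> X \<Longrightarrow> (x, y) \<in> (link G L u)\<^sup>*"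
  by (auto simp: link_def)

context group
begin

lemma gen_modI:
  assumes "X \<subseteq> carrier G" "L \<subseteq> carrier G"
    and "\<And>H. subgroup H G \<Longrightarrow> X \<subseteq> H \<Longrightarrow> L \<subseteq> H \<Longrightarrow> H = carrier G"
  shows "gen_mod G L X"
  unfolding gen_mod_def
  using assms generate_is_subgroup[of "X \<union> L"] generate.incl[of _ "X \<union> L" G] by blast

lemma gen_modE:
  assumes "gen_mod G L X" "subgroup H G" "X \<subseteq> H" "L \<subseteq> H"
  shows "H = carrier G"
  using assms generate_subgroup_incl[of "X \<union> L" H] subgroup.subset[of H G]
  by (auto simp: gen_mod_def)

lemma not_gen_modE:
  assumes "\<not> gen_mod G L X" "X \<subseteq> carrier G" "L \<subseteq> carrier G"
  obtains H where "subgroup H G" "X \<subseteq> H" "L \<subseteq> H" "H \<noteq> carrier G"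
  using gen_modI[OF assms(2,3)] assms(1) by auto

lemma not_gen_modI:
  assumes "subgroup H G" "X \<subseteq> H" "L \<subseteq> H" "H \<noteq> carrier G"
  shows "\<not> gen_mod G L X"
  using assms gen_modE by blast

lemma gen_mod_mono:
  assumes "gen_mod G L X" "X \<subseteq> Y" "L \<subseteq> M" "Y \<subseteq> carrier G" "M \<subseteq> carrier G"
  shows "gen_mod G M Y"
proof (rule gen_modI[OF assms(4,5)])
  show "H = carrier G" if "subgroup H G" "Y \<subseteq> H" "M \<subseteq> H" for H
    using that assms by (intro gen_modE[OF assms(1)]) auto
qed

end

section \<open>Congruence modulo a normal subgroup and change of representatives\<close>

lemma (in normal) rcos_eq_iff:
  assumes "x \<in> carrier G" "y \<in> carrier G"
  shows "H #> x = H #> y \<longleftrightarrow> x \<otimes> inv y \<in> H"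
proof
  assume "H #> x = H #> y"
  then have "x \<in> H #> y" using rcos_self[OF assms(1) subgroup_axioms] by simp
  then show "x \<otimes> inv y \<in> H" using rcos_module[OF is_group assms(2,1)] by simp
next
  assume "x \<otimes> inv y \<in> H"
  then have "x \<in> H #> y" using rcos_module[OF is_group assms(2,1)] by simp
  then show "H #> x = H #> y" using repr_independence[OF _ assms(2) subgroup_axioms] by simp
qed

lemma (in normal) rcos_mult_cong:
  assumes "x \<in> carrier G" "y \<in> carrier G" "x' \<in> carrier G" "y' \<in> carrier G"
    "H #> x = H #> x'" "H #> y = H #> y'"
  shows "H #> (x \<otimes> y) = H #> (x' \<otimes> y')"
  unfolding rcos_sum[OF assms(1,2), symmetric] rcos_sum[OF assms(3,4), symmetric] assms(5,6) ..

lemma (in normal) rcos_inv_cong: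
  assumes "x \<in> carrier G" "x' \<in> carrier G" "H #> x = H #> x'"
  shows "H #> inv x = H #> inv x'"
  unfolding rcos_inv[OF assms(1), symmetric] rcos_inv[OF assms(2), symmetric] assms(3) ..

lemma (in normal) mem_rcos_iff:
  assumes "y \<in> carrier G"
  shows "x \<in> H #> y \<longleftrightarrow> x \<in> carrier G \<and> H #> x = H #> y"
proof
  assume x: "x \<in> H #> y"
  show "x \<in> carrier G \<and> H #> x = H #> y"
    using repr_independence[OF x assms subgroup_axioms] elemrcos_carrier[OF is_group assms x] by blast
next
  assume x: "x \<in> carrier G \<and> H #> x = H #> y"
  then have "x \<in> H #> x" using rcos_self[OF _ subgroup_axioms] by blast
  then show "x \<in> H #> y" using x by blast
qed

text \<open>The set is the product \<open>H K\<close>, described as the full preimage of the image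
  of \<open>K\<close> in the quotient by \<open>H\<close>.\<close>

lemma (in normal) subgroup_mod:
  assumes K: "subgroup K G"
  shows "subgroup {g \<in> carrier G. \<exists>k\<in>K. H #> k = H #> g} G"
proof (rule subgroupI)
  have Kc: "k \<in> K \<Longrightarrow> k \<in> carrier G" for k
    using subgroup.subset[OF K] by blast
  show "{g \<in> carrier G. \<exists>k\<in>K. H #> k = H #> g} \<noteq> {}"
    using subgroup.one_closed[OF K] by blast
  fix a assume a: "a \<in> {g \<in> carrier G. \<exists>k\<in>K. H #> k = H #> g}"
  then obtain k where k: "k \<in> K" "H #> k = H #> a" by blast
  then have "H #> inv k = H #> inv a"
    using a Kc by (intro rcos_inv_cong) auto
  then show "inv a \<in> {g \<in> carrier G. \<exists>k\<in>K. H #> k = H #> g}"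
    using a k subgroup.m_inv_closed[OF K, of k] by blast
  fix b assume b: "b \<in> {g \<in> carrier G. \<exists>k\<in>K. H #> k = H #> g}"
  then obtain l where l: "l \<in> K" "H #> l = H #> b" by blast
  have "H #> (k \<otimes> l) = H #> (a \<otimes> b)"
    using a b k l Kc by (intro rcos_mult_cong) auto
  then show "a \<otimes> b \<in> {g \<in> carrier G. \<exists>k\<in>K. H #> k = H #> g}"
    using a b k l subgroup.m_closed[OF K, of k l] by blast
qed auto

text \<open>The subgroup \<open>H K\<close> of \<open>subgroup_mod\<close> contains both
  \<open>X\<close> and \<open>H\<close>, hence is the whole group.\<close>

lemma (in normal) gen_mod_cosets:
  assumes X: "gen_mod G H X" and K: "subgroup K G" "X \<subseteq> K" and g: "g \<in> carrier G"
  shows "\<exists>k\<in>K. H #> k = H #> g"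
proof -
  have "h \<in> H \<Longrightarrow> \<exists>k\<in>K. H #> k = H #> h" for h
    using subgroup.one_closed[OF K(1)] rcos_const[OF is_group] subgroup.one_closed[OF subgroup_axioms]
    by (metis)
  moreover have "X \<subseteq> carrier G" using X by (rule gen_modD)
  ultimately have "{g \<in> carrier G. \<exists>k\<in>K. H #> k = H #> g} = carrier G"
    using K subset by (intro gen_modE[OF X subgroup_mod[OF K(1)]]) auto
  then show ?thesis using g by blast
qed

text \<open>A subgroup that contains \<open>H\<close> and \<open>y\<close> contains the whole coset
  of \<open>y\<close>, so only the cosets that are met matter.\<close>

lemma (in normal) gen_mod_cong:
  assumes X: "gen_mod G H X" and Y: "Y \<subseteq> carrier G"
    and XY: "\<And>x. x \<in> X \<Longrightarrow> \<exists>y\<in>Y. H #> y = H #> x"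
  shows "gen_mod G H Y"
proof (rule gen_modI[OF Y subset])
  fix K assume K: "subgroup K G" "Y \<subseteq> K" "H \<subseteq> K"
  have "X \<subseteq> K"
  proof
    fix x assume x: "x \<in> X"
    then obtain y where y: "y \<in> Y" "H #> y = H #> x" using XY by blast
    have xc: "x \<in> carrier G" using gen_modD[OF X] x by blast
    have yc: "y \<in> carrier G" using y Y by blast
    have "x \<otimes> inv y \<in> H" using rcos_eq_iff[OF xc yc] y by simp
    then have "x \<otimes> inv y \<otimes> y \<in> K" using K y subgroup.m_closed[OF K(1)] by blast
    then show "x \<in> K" using xc yc by (simp add: m_assoc)
  qed
  then show "K = carrier G" using gen_modE[OF X] K by blast
qed

text \<open>Of two congruent members one could be dropped without losing generation.\<close>

lemma (in normal) min_gen_mod_inj: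
  assumes X: "X \<in> min_gen_mod G H u" and x: "x \<in> X" "y \<in> X" "H #> x = H #> y"
  shows "x = y"
proof (rule ccontr)
  assume "x \<noteq> y"
  then have "\<exists>z\<in>X - {x}. H #> z = H #> w" if "w \<in> X" for w
    using x that by (cases "w = x") auto
  then have "gen_mod G H (X - {x})"
    using min_gen_modD(2)[OF X] by (intro gen_mod_cong[OF min_gen_modD(1)[OF X]]) auto
  moreover have "X - {x} \<subset> X" using x by blast
  ultimately show False using min_gen_modD(4)[OF X] by blast
qed

lemma (in normal) min_gen_mod_lift:
  assumes X: "X \<in> min_gen_mod G H u" and f: "\<And>x. x \<in> X \<Longrightarrow> f x \<in> H #> x"
  shows "f ` X \<in> min_gen_mod G H u" "inj_on f X"
proof -
  have Xc: "X \<subseteq> carrier G" by (rule min_gen_modD[OF X])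
  have f': "f x \<in> carrier G" "H #> f x = H #> x" if "x \<in> X" for x
    using f[OF that] Xc that mem_rcos_iff by blast+
  show inj: "inj_on f X"
    using f'(2) by (intro inj_onI) (metis min_gen_mod_inj[OF X])
  have "gen_mod G H (f ` X)"
    using f' by (intro gen_mod_cong[OF min_gen_modD(1)[OF X]]) auto
  moreover have "card (f ` X) = u" using inj min_gen_modD(3)[OF X] by (simp add: card_image)
  moreover have "\<not> gen_mod G H Y" if YX: "Y \<subset> f ` X" for Y
  proof
    assume Y: "gen_mod G H Y"
    \<comment> \<open>A generating proper subset \<open>Y\<close> of the lift pulls back to
      \<open>?Z\<close>, which represents the same cosets and is a proper subset of
      \<open>X\<close>.\<close>
    let ?Z = "{x \<in> X. f x \<in> Y}"
    have "gen_mod G H ?Z"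
    proof (rule gen_mod_cong[OF Y])
      fix y assume "y \<in> Y"
      then obtain x where "x \<in> X" "y = f x" using YX by blast
      then show "\<exists>z\<in>?Z. H #> z = H #> y" using f' \<open>y \<in> Y\<close> by (intro bexI[of _ x]) auto
    qed (use Xc in auto)
    moreover have "?Z \<subset> X" using that by blast
    ultimately show False using min_gen_modD(4)[OF X] by blast
  qed
  ultimately show "f ` X \<in> min_gen_mod G H u" by (auto simp: min_gen_mod_def)
qed

section \<open>Complements of an abelian chief factor\<close>

locale chief_factor = group G + L: normal L G + N: normal N G for G (structure) and L N +
  assumes fin: "finite (carrier G)"
    and less: "L \<subset> N"
    and minimal: "P \<lhd> G \<Longrightarrow> L \<subseteq> P \<Longrightarrow> P \<subseteq> N \<Longrightarrow> P = L \<or> P = N"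
    and comm: "a \<in> N \<Longrightarrow> b \<in> N \<Longrightarrow> L #> (a \<otimes> b) = L #> (b \<otimes> a)"

context chief_factor
begin

text \<open>The preimages of the complements of \<open>N / L\<close> in \<open>G / L\<close>; that they meet \<open>N\<close> only in \<open>L\<close> is
  automatic (\<open>supps_inter\<close>).\<close>

definition supps :: "'a set set" where
  "supps = {K. subgroup K G \<and> L \<subseteq> K \<and> K \<noteq> carrier G \<and>
     (\<forall>g\<in>carrier G. \<exists>k\<in>K. N #> k = N #> g)}"

lemma suppsD:
  assumes "K \<in> supps"
  shows "subgroup K G" "L \<subseteq> K" "K \<noteq> carrier G" "K \<subseteq> carrier G"
    "g \<in> carrier G \<Longrightarrow> \<exists>k\<in>K. N #> k = N #> g"
  using assms subgroup.subset by (auto simp: supps_def)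

lemma L_le_N: "L \<subseteq> N" using less by blast

lemma N_cong_L:
  assumes "x \<in> carrier G" "y \<in> carrier G" "L #> x = L #> y"
  shows "N #> x = N #> y"
  using assms L.rcos_eq_iff N.rcos_eq_iff L_le_N by blast

lemma gen_mod_N: "gen_mod G L X \<Longrightarrow> gen_mod G N X"
  using gen_mod_mono[of L X X N] L_le_N N.subset by (auto simp: gen_mod_def)

lemma supps_gen:
  assumes "gen_mod G N X" "subgroup K G" "X \<subseteq> K" "L \<subseteq> K" "K \<noteq> carrier G"
  shows "K \<in> supps"
  using assms N.gen_mod_cosets[OF assms(1-3)] by (auto simp: supps_def)

text \<open>\<open>K \<inter> N\<close> is normalised by \<open>K\<close>, and modulo
  \<open>L\<close> it is centralised by the abelian \<open>N / L\<close>; since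
  \<open>G = N K\<close>, it is normal in \<open>G\<close>. By minimality it is \<open>L\<close> or
  \<open>N\<close>, and \<open>N \<subseteq> K\<close> would give \<open>K = G\<close>.\<close>

lemma supps_inter: assumes K: "K \<in> supps" shows "K \<inter> N = L"
proof -
  note Ks = suppsD(1)[OF K] and LK = suppsD(2)[OF K]
  have Kc: "\<And>k. k \<in> K \<Longrightarrow> k \<in> carrier G" using suppsD(4)[OF K] by blast
  have Nc: "\<And>k. k \<in> N \<Longrightarrow> k \<in> carrier G" using N.subset by blast
  have sub: "subgroup (K \<inter> N) G"
    using subgroups_Inter_pair[OF Ks N.subgroup_axioms] .
  have "x \<otimes> h \<otimes> inv x \<in> K \<inter> N" if x: "x \<in> carrier G" and h: "h \<in> K \<inter> N" for x h
  proof -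
    obtain k where k: "k \<in> K" "N #> k = N #> x" using suppsD(5)[OF K x] by blast
    \<comment> \<open>With \<open>x = n \<otimes> k\<close>, conjugation by \<open>k\<close> keeps
      \<open>h\<close> in \<open>K \<inter> N\<close>, and conjugation by \<open>n\<close> changes
      the result only by an element of \<open>L \<subseteq> K\<close>.\<close>
    define n where "n = x \<otimes> inv k"
    have n: "n \<in> N" using N.rcos_eq_iff[of x k] x k Kc by (simp add: n_def)
    have xn: "x = n \<otimes> k" using x k Kc by (simp add: n_def m_assoc)
    define q where "q = k \<otimes> h \<otimes> inv k"
    have qN: "q \<in> N" using h k Kc N.inv_op_closed2 by (simp add: q_def)
    have qK: "q \<in> K" using h k subgroup.m_closed[OF Ks] subgroup.m_inv_closed[OF Ks]
      by (simp add: q_def)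
    note c = Nc[OF n] Nc[OF qN] Kc[OF k(1)] Kc[of h]
    have "L #> (n \<otimes> q) = L #> (q \<otimes> n)" by (rule comm[OF n qN])
    then have "n \<otimes> q \<otimes> inv (q \<otimes> n) \<in> K"
      using L.rcos_eq_iff[of "n \<otimes> q" "q \<otimes> n"] c LK by auto
    then have "n \<otimes> q \<otimes> inv (q \<otimes> n) \<otimes> q \<in> K" using qK subgroup.m_closed[OF Ks] by blast
    moreover have "n \<otimes> q \<otimes> inv (q \<otimes> n) \<otimes> q = n \<otimes> q \<otimes> inv n"
      using c by (simp add: inv_mult_group m_assoc)
    moreover have "x \<otimes> h \<otimes> inv x = n \<otimes> q \<otimes> inv n"
      unfolding xn q_def using c h Kc[OF k(1)] by (simp add: inv_mult_group m_assoc)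
    ultimately have "x \<otimes> h \<otimes> inv x \<in> K" by (simp only:)
    moreover have "x \<otimes> h \<otimes> inv x \<in> N" using N.inv_op_closed2[OF x] h by blast
    ultimately show ?thesis by blast
  qed
  then have "K \<inter> N \<lhd> G" using sub normal_inv_iff by blast
  then have "K \<inter> N = L \<or> K \<inter> N = N" using minimal L_le_N LK by blast
  moreover have "K \<inter> N \<noteq> N"
  proof
    assume "K \<inter> N = N"
    then have NK: "N \<subseteq> K" by blast
    have "g \<in> K" if g: "g \<in> carrier G" for g
    proof -
      obtain k where k: "k \<in> K" "N #> k = N #> g" using suppsD(5)[OF K g] by blast
      have "g \<otimes> inv k \<in> K" using N.rcos_eq_iff[of g k] g k Kc NK by auto
      then have "g \<otimes> inv k \<otimes> k \<in> K" using k(1) subgroup.m_closed[OF Ks] by blast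
      then show ?thesis using g k Kc by (simp add: m_assoc)
    qed
    then show False using suppsD(3,4)[OF K] by blast
  qed
  ultimately show ?thesis by blast
qed

lemma supps_eq_mod_L:
  assumes K: "K \<in> supps" and g: "g \<in> K" "h \<in> K" "N #> g = N #> h"
  shows "g \<otimes> inv h \<in> L"
proof -
  have "g \<in> carrier G" "h \<in> carrier G" using g suppsD(4)[OF K] by auto
  then have "g \<otimes> inv h \<in> N" using N.rcos_eq_iff g(3) by blast
  moreover have "g \<otimes> inv h \<in> K"
    using g suppsD(1)[OF K] subgroup.m_closed subgroup.m_inv_closed by metis
  ultimately show ?thesis using supps_inter[OF K] by blast
qed

text \<open>A proper subgroup above \<open>K\<close> again lies in \<open>supps\<close>, so two of
  its elements that are congruent modulo \<open>N\<close> differ by an element of \<open>L\<close>.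
  As \<open>K\<close> meets every coset of \<open>N\<close>, each of its elements lies in
  \<open>K\<close>.\<close>

lemma supps_maximal:
  assumes K: "K \<in> supps" and H: "subgroup H G" "K \<subseteq> H" "H \<noteq> carrier G"
  shows "H = K"
proof -
  have "\<exists>k\<in>H. N #> k = N #> g" if "g \<in> carrier G" for g
    using suppsD(5)[OF K that] H(2) by blast
  then have HS: "H \<in> supps" using H suppsD(2)[OF K] by (auto simp: supps_def)
  have "h \<in> K" if h: "h \<in> H" for h
  proof -
    have hc: "h \<in> carrier G" using h suppsD(4)[OF HS] by blast
    obtain k where k: "k \<in> K" "N #> k = N #> h" using suppsD(5)[OF K hc] by blast
    have kc: "k \<in> carrier G" using k suppsD(4)[OF K] by blast
    have "h \<otimes> inv k \<in> K" using supps_eq_mod_L[OF HS h] k H suppsD(2)[OF K] by auto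
    then have "h \<otimes> inv k \<otimes> k \<in> K" using k(1) subgroup.m_closed[OF suppsD(1)[OF K]] by blast
    then show ?thesis using hc kc by (simp add: m_assoc)
  qed
  then show ?thesis using H by blast
qed

text \<open>A complement represents each coset of \<open>N\<close> exactly once modulo
  \<open>L\<close>; this gives the factor \<open>card L\<close> per coordinate when lifts are
  counted.\<close>

lemma supps_rcos:
  assumes K: "K \<in> supps" and k: "k \<in> K" "N #> k = N #> g" and g: "g \<in> carrier G"
  shows "K \<inter> (N #> g) = L #> k"
proof -
  have kc: "k \<in> carrier G" using k suppsD(4)[OF K] by blast
  have "x \<in> K \<inter> (N #> g) \<longleftrightarrow> x \<in> L #> k" for x
  proof
    assume x: "x \<in> K \<inter> (N #> g)"
    then have "x \<otimes> inv k \<in> L"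
      using k by (intro supps_eq_mod_L[OF K]) (auto simp: N.mem_rcos_iff[OF g])
    moreover have "x \<in> carrier G" using x suppsD(4)[OF K] by blast
    ultimately show "x \<in> L #> k" using L.rcos_module[OF is_group kc] by blast
  next
    assume x: "x \<in> L #> k"
    then have xc: "x \<in> carrier G" "L #> x = L #> k" using L.mem_rcos_iff[OF kc] by auto
    have "x \<otimes> inv k \<otimes> k \<in> K"
      using L.rcos_module_imp[OF is_group kc x] suppsD(2)[OF K] k(1) 
        subgroup.m_closed[OF suppsD(1)[OF K]] by blast
    then have "x \<in> K" using xc kc by (simp add: m_assoc)
    then show "x \<in> K \<inter> (N #> g)" using N_cong_L[OF xc(1) kc xc(2)] k(2) xc N.mem_rcos_iff[OF g] by simp
  qed
  then show ?thesis by blast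
qed

section \<open>Counting the lifts that generate modulo \<open>L\<close>\<close>

lemma card_rcos: "subgroup H G \<Longrightarrow> g \<in> carrier G \<Longrightarrow> card (H #> g) = card H"
  using card_cosets_equal[OF rcosetsI[of H g]] subgroup.subset[of H G] bij_betw_same_card by metis

lemma card_supps_rcos:
  assumes K: "K \<in> supps" and g: "g \<in> carrier G"
  shows "card (K \<inter> (N #> g)) = card L"
proof -
  obtain k where k: "k \<in> K" "N #> k = N #> g" using suppsD(5)[OF K g] by blast
  have "k \<in> carrier G" using k suppsD(4)[OF K] by blast
  then show ?thesis using supps_rcos[OF K k g] card_rcos[OF L.subgroup_axioms] by simp
qed

lemma finite_supps: "finite supps"
  using fin by (rule finite_subset[rotated, OF finite_Pow_iff[THEN iffD2]]) (auto dest: suppsD)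

lemma supps_not_gen:
  assumes "gen_mod G N X" "\<not> gen_mod G L X"
  shows "\<exists>K\<in>supps. X \<subseteq> K"
  using not_gen_modE[OF assms(2) gen_modD[OF assms(1)] L.subset] supps_gen[OF assms(1)] by metis

text \<open>The intersection still contains \<open>X\<close>, so it lies in \<open>supps\<close> and
  is itself maximal. This uniqueness makes the union of bad lifts in \<open>lift_count\<close>
  disjoint.\<close>

lemma supps_unique:
  assumes X: "gen_mod G N X" and K: "K \<in> supps" "X \<subseteq> K" and H: "H \<in> supps" "X \<subseteq> H"
  shows "H = K"
proof -
  have "subgroup (H \<inter> K) G" using suppsD(1) H K subgroups_Inter_pair by blast
  moreover have "L \<subseteq> H \<inter> K" "X \<subseteq> H \<inter> K" using H K suppsD(2) by auto
  moreover have "H \<inter> K \<noteq> carrier G" using suppsD(3,4) H(1) by blast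
  ultimately have HK: "H \<inter> K \<in> supps" using supps_gen[OF X] by blast
  have "H = H \<inter> K"
    by (rule supps_maximal[OF HK suppsD(1)[OF H(1)] _ suppsD(3)[OF H(1)]]) blast
  moreover have "K = H \<inter> K"
    by (rule supps_maximal[OF HK suppsD(1)[OF K(1)] _ suppsD(3)[OF K(1)]]) blast
  ultimately show ?thesis by blast
qed

text \<open>Gaschuetz's argument: a lift of \<open>X\<close> fails together with \<open>T\<close>
  exactly when both lie in a complement, and that complement is unique. Each complement containing
  \<open>T\<close> contains \<open>card L ^ card X\<close> of the \<open>card N ^ card X\<close>
  lifts, so \<open>X\<close> enters only through its size.\<close>

lemma lift_count:
  assumes X: "finite X" and T: "T \<union> X \<subseteq> carrier G" and gen: "gen_mod G N (T \<union> X)"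
  shows "(\<exists>f. (\<forall>x\<in>X. f x \<in> N #> x) \<and> gen_mod G L (T \<union> f ` X)) \<longleftrightarrow>
    card {K \<in> supps. T \<subseteq> K} * card L ^ card X < card N ^ card X"
    and "card {K \<in> supps. T \<subseteq> K} * card L ^ card X \<le> card N ^ card X"
proof -
  define A where "A = PiE X (\<lambda>x. N #> x)"
  define B where "B = {f \<in> A. \<not> gen_mod G L (T \<union> f ` X)}"
  define C where "C K = PiE X (\<lambda>x. K \<inter> (N #> x))" for K
  have cX: "x \<in> carrier G" if "x \<in> X" for x using T that by blast
  have genf: "gen_mod G N (T \<union> f ` X)" if "f \<in> A" for f
  proof (rule N.gen_mod_cong[OF gen])
    have f: "f x \<in> carrier G" "N #> f x = N #> x" if "x \<in> X" for x
      using \<open>f \<in> A\<close> that N.mem_rcos_iff[OF cX[OF that], of "f x"] by (auto simp: A_def)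
    show "T \<union> f ` X \<subseteq> carrier G" using f T by auto
    show "\<exists>y\<in>T \<union> f ` X. N #> y = N #> x" if "x \<in> T \<union> X" for x
      using that f by auto
  qed
  have CA: "C K \<subseteq> A" for K unfolding A_def C_def by (intro PiE_mono) auto
  have CK: "f ` X \<subseteq> K" if "f \<in> C K" for f K using that by (auto simp: C_def)
  have B: "B = (\<Union>K\<in>{K \<in> supps. T \<subseteq> K}. C K)"
  proof (intro equalityI subsetI)
    fix f assume f: "f \<in> B"
    then obtain K where K: "K \<in> supps" "T \<union> f ` X \<subseteq> K"
      using supps_not_gen[OF genf, of f] unfolding B_def by blast
    then have "f \<in> C K" using f by (auto simp: B_def A_def C_def PiE_iff)
    then show "f \<in> (\<Union>K\<in>{K \<in> supps. T \<subseteq> K}. C K)" using K by blast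
  next
    fix f assume "f \<in> (\<Union>K\<in>{K \<in> supps. T \<subseteq> K}. C K)"
    then obtain K where K: "K \<in> supps" "T \<subseteq> K" "f \<in> C K" by blast
    then have "\<not> gen_mod G L (T \<union> f ` X)"
      using suppsD[OF K(1)] CK[OF K(3)] by (intro not_gen_modI[of K]) auto
    then show "f \<in> B" using CA K by (auto simp: B_def)
  qed
  have finA: "finite A"
    unfolding A_def using X cX finite_subset[OF r_coset_subset_G[OF N.subset] fin]
    by (intro finite_PiE) auto
  have "card B = (\<Sum>K\<in>{K \<in> supps. T \<subseteq> K}. card (C K))"
    unfolding B
  proof (rule card_UN_disjoint)
    show "finite {K \<in> supps. T \<subseteq> K}" using finite_supps by simp
    show "\<forall>K\<in>{K \<in> supps. T \<subseteq> K}. finite (C K)" using CA finA finite_subset by blast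
    have "K = H" if "K \<in> supps" "T \<subseteq> K" "H \<in> supps" "T \<subseteq> H" "f \<in> C K" "f \<in> C H" for K H f
      using supps_unique[OF genf, of f H K] CA CK that by blast
    then show "\<forall>K\<in>{K \<in> supps. T \<subseteq> K}. \<forall>H\<in>{K \<in> supps. T \<subseteq> K}. K \<noteq> H \<longrightarrow> C K \<inter> C H = {}"
      by blast
  qed
  also have "\<dots> = (\<Sum>K\<in>{K \<in> supps. T \<subseteq> K}. card L ^ card X)"
    by (intro sum.cong refl) (use X cX in \<open>simp add: C_def card_PiE card_supps_rcos\<close>)
  finally have cB: "card B = card {K \<in> supps. T \<subseteq> K} * card L ^ card X" by simp
  have cA: "card A = card N ^ card X"
    using X cX card_rcos[OF N.subgroup_axioms] by (simp add: A_def card_PiE)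
  have BA: "B \<subseteq> A" by (auto simp: B_def)
  have "(\<exists>f. (\<forall>x\<in>X. f x \<in> N #> x) \<and> gen_mod G L (T \<union> f ` X)) \<longleftrightarrow> (\<exists>f\<in>A. f \<notin> B)"
  proof
    assume "\<exists>f. (\<forall>x\<in>X. f x \<in> N #> x) \<and> gen_mod G L (T \<union> f ` X)"
    then obtain f where f: "\<forall>x\<in>X. f x \<in> N #> x" "gen_mod G L (T \<union> f ` X)" by blast
    \<comment> \<open>Members of \<open>A\<close> are \<open>undefined\<close> outside
      \<open>X\<close>, so an arbitrary lift is first restricted.\<close>
    have "restrict f X ` X = f ` X" by (rule image_cong) auto
    then have "restrict f X \<in> A" "restrict f X \<notin> B" using f by (auto simp: A_def B_def)
    then show "\<exists>f\<in>A. f \<notin> B" by blast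
  qed (auto simp: B_def A_def)
  also have "\<dots> \<longleftrightarrow> B \<noteq> A" using BA by blast
  also have "\<dots> \<longleftrightarrow> card B < card A"
    using BA finA card_mono card_seteq psubset_card_mono by (metis less_irrefl psubsetI)
  finally show "(\<exists>f. (\<forall>x\<in>X. f x \<in> N #> x) \<and> gen_mod G L (T \<union> f ` X)) \<longleftrightarrow>
      card {K \<in> supps. T \<subseteq> K} * card L ^ card X < card N ^ card X"
    unfolding cA cB .
  show "card {K \<in> supps. T \<subseteq> K} * card L ^ card X \<le> card N ^ card X"
    using card_mono[OF finA BA] unfolding cA cB .
qed

text \<open>Modulo \<open>L\<close> such triples multiply componentwise, because \<open>N / L\<close> is abelian.\<close>

lemma supps_heap:
  assumes K: "K1 \<in> supps" "K2 \<in> supps" "K3 \<in> supps"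
  defines "S \<equiv> {g1 \<otimes> inv g2 \<otimes> g3 | g1 g2 g3. g1 \<in> K1 \<and> g2 \<in> K2 \<and> g3 \<in> K3 \<and>
      N #> g1 = N #> g2 \<and> N #> g2 = N #> g3}"
  shows "subgroup S G" "S \<noteq> carrier G" "L \<subseteq> S"
proof -
  note Kc = suppsD(4)[OF K(1), THEN subsetD] suppsD(4)[OF K(2), THEN subsetD]
    suppsD(4)[OF K(3), THEN subsetD]
  note sub = suppsD(1)[OF K(1)] suppsD(1)[OF K(2)] suppsD(1)[OF K(3)]
  have Sc: "S \<subseteq> carrier G" using Kc by (auto simp: S_def)
  have Lc: "\<And>l. l \<in> L \<Longrightarrow> l \<in> carrier G" using L.subset by blast
  show LS: "L \<subseteq> S"
  proof
    fix l assume l: "l \<in> L"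
    have "l = \<one> \<otimes> inv \<one> \<otimes> l" using Lc[OF l] by simp
    moreover have "N #> l = N" using N.rcos_const[OF is_group] l L_le_N by blast
    moreover have "N #> \<one> = N" by (rule coset_mult_one[OF N.subset])
    moreover have "\<one> \<in> K1" "\<one> \<in> K2" "l \<in> K3"
      using l suppsD(2)[OF K(3)] sub[THEN subgroup.one_closed] by auto
    ultimately show "l \<in> S" unfolding S_def by blast
  qed
  have mult: "a \<otimes> b \<in> S" if ab: "a \<in> S" "b \<in> S" for a b
  proof -
    obtain g1 g2 g3 where g: "g1 \<in> K1" "g2 \<in> K2" "g3 \<in> K3" "N #> g1 = N #> g2" "N #> g2 = N #> g3"
      "a = g1 \<otimes> inv g2 \<otimes> g3" using ab(1) by (auto simp: S_def)
    obtain h1 h2 h3 where h: "h1 \<in> K1" "h2 \<in> K2" "h3 \<in> K3" "N #> h1 = N #> h2" "N #> h2 = N #> h3"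
      "b = h1 \<otimes> inv h2 \<otimes> h3" using ab(2) by (auto simp: S_def)
    note c = Kc(1)[OF g(1)] Kc(2)[OF g(2)] Kc(3)[OF g(3)] Kc(1)[OF h(1)] Kc(2)[OF h(2)] Kc(3)[OF h(3)]
    \<comment> \<open>The product contains \<open>m \<otimes> n\<close>, whereas a product of
      triples needs \<open>n \<otimes> m\<close>. Both factors lie in \<open>N\<close>, so they
      commute up to a correction \<open>l\<close> in \<open>L\<close>.\<close>
    define m n where "m = inv g2 \<otimes> g3" and "n = h1 \<otimes> inv h2"
    have mc: "m \<in> carrier G" "n \<in> carrier G" using c by (auto simp: m_def n_def)
    have n: "n \<in> N" using N.rcos_eq_iff c h(4) by (simp add: n_def)
    have "N #> (inv g2 \<otimes> g3) = N #> (inv g3 \<otimes> g3)"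
      using c g by (intro N.rcos_mult_cong N.rcos_inv_cong) auto
    then have m: "m \<in> N" using rcos_self[OF _ N.subgroup_axioms, of m] c mc N.subset by (simp add: m_def)
    define l where "l = inv (n \<otimes> m) \<otimes> (m \<otimes> n)"
    have "L #> (inv (n \<otimes> m) \<otimes> (m \<otimes> n)) = L #> (inv (n \<otimes> m) \<otimes> (n \<otimes> m))"
      using mc by (intro L.rcos_mult_cong[OF _ _ _ _ refl comm[OF m n]]) auto
    then have l: "l \<in> L" using rcos_self[OF _ L.subgroup_axioms, of l] mc L.subset by (simp add: l_def)
    \<comment> \<open>Moved past \<open>h3\<close>, the correction becomes \<open>l'\<close>, which
      \<open>K3\<close> absorbs because \<open>L \<subseteq> K3\<close>.\<close>
    define l' where "l' = inv h3 \<otimes> l \<otimes> h3"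
    have l': "l' \<in> L" using L.inv_op_closed1[OF c(6) l] by (simp add: l'_def)
    have lc: "l \<in> carrier G" "l' \<in> carrier G" using l l' Lc by auto
    have "a \<otimes> b = g1 \<otimes> (m \<otimes> n) \<otimes> h3" using c mc by (simp add: g(6) h(6) m_def n_def m_assoc)
    also have "m \<otimes> n = n \<otimes> m \<otimes> l" using mc by (simp add: l_def m_assoc[symmetric])
    also have "g1 \<otimes> (n \<otimes> m \<otimes> l) \<otimes> h3 = (g1 \<otimes> h1) \<otimes> inv (g2 \<otimes> h2) \<otimes> (g3 \<otimes> h3 \<otimes> l')"
    proof -
      have "l \<otimes> h3 = h3 \<otimes> l'" using c lc by (simp add: l'_def m_assoc[symmetric])
      then have "g1 \<otimes> (n \<otimes> m \<otimes> l) \<otimes> h3 = g1 \<otimes> (n \<otimes> m) \<otimes> (h3 \<otimes> l')"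
        using c lc mc by (simp add: m_assoc)
      then show ?thesis using c lc by (simp add: m_def n_def m_assoc inv_mult_group)
    qed
    finally have ab': "a \<otimes> b = (g1 \<otimes> h1) \<otimes> inv (g2 \<otimes> h2) \<otimes> (g3 \<otimes> h3 \<otimes> l')" .
    have "g1 \<otimes> h1 \<in> K1" "g2 \<otimes> h2 \<in> K2" "g3 \<otimes> h3 \<otimes> l' \<in> K3"
      using sub g h l' suppsD(2)[OF K(3)] by (auto intro!: subgroup.m_closed)
    moreover have "N #> (g1 \<otimes> h1) = N #> (g2 \<otimes> h2)"
      using c g h by (intro N.rcos_mult_cong) auto
    moreover have "N #> (g2 \<otimes> h2) = N #> (g3 \<otimes> h3 \<otimes> l')"
    proof -
      have "N #> (g3 \<otimes> h3 \<otimes> l') = N #> (g3 \<otimes> h3 \<otimes> \<one>)"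
        using c lc l' L_le_N N.rcos_const[OF is_group, of l'] N.subset
        by (intro N.rcos_mult_cong) auto
      also have "\<dots> = N #> (g2 \<otimes> h2)" using c g h N.rcos_mult_cong[of g3 h3 g2 h2] by simp
      finally show ?thesis by simp
    qed
    ultimately show "a \<otimes> b \<in> S" unfolding S_def using ab' by blast
  qed
  have one: "\<one> \<in> S" using LS subgroup.one_closed[OF L.subgroup_axioms] by blast
  \<comment> \<open>Inverses come from finiteness: left multiplication by \<open>a\<close> is an
    injection of \<open>S\<close> into itself, hence hits \<open>\<one>\<close>.\<close>
  have "inv a \<in> S" if a: "a \<in> S" for a
  proof -
    have ac: "a \<in> carrier G" using a Sc by blast
    have "(\<lambda>s. a \<otimes> s) ` S = S"
    proof (rule endo_inj_surj)
      show "finite S" using Sc fin by (rule finite_subset)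
      show "(\<lambda>s. a \<otimes> s) ` S \<subseteq> S" using mult[OF a] by blast
      show "inj_on (\<lambda>s. a \<otimes> s) S" using ac subsetD[OF Sc] Units_l_cancel by (intro inj_onI) auto
    qed
    then obtain s where s: "s \<in> S" "a \<otimes> s = \<one>" using one by (metis imageE)
    then have "inv a = s" using ac Sc inv_unique'[of a s] inv_comm by blast
    then show ?thesis using s by simp
  qed
  then show "subgroup S G" using mult one Sc by (intro subgroupI) auto
  \<comment> \<open>Properness: a product that lies in \<open>N\<close> forces all three factors
    into \<open>N\<close>, hence into \<open>L\<close>, and \<open>N\<close> is strictly larger than
    \<open>L\<close>.\<close>
  have "S \<inter> N \<subseteq> L"
  proof
    fix a assume a: "a \<in> S \<inter> N"
    then obtain g1 g2 g3 where g: "g1 \<in> K1" "g2 \<in> K2" "g3 \<in> K3" "N #> g1 = N #> g2" "N #> g2 = N #> g3"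
      "a = g1 \<otimes> inv g2 \<otimes> g3" by (auto simp: S_def)
    note c = Kc(1)[OF g(1)] Kc(2)[OF g(2)] Kc(3)[OF g(3)]
    have "N #> (g1 \<otimes> inv g2) = N #> (g2 \<otimes> inv g2)"
      using c g by (intro N.rcos_mult_cong) auto
    then have "N #> (g1 \<otimes> inv g2 \<otimes> g3) = N #> (\<one> \<otimes> g3)"
      using c by (intro N.rcos_mult_cong) auto
    then have "N #> g3 = N" using c g(6) a N.rcos_const[OF is_group, of a] by simp
    then have "g1 \<in> N" "g2 \<in> N" "g3 \<in> N" using g c rcos_self[OF _ N.subgroup_axioms] by blast+
    then have "g1 \<in> L" "g2 \<in> L" "g3 \<in> L" using g K supps_inter by auto
    then show "a \<in> L" using g(6) by (simp add: L.m_closed L.m_inv_closed)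
  qed
  then show "S \<noteq> carrier G" using less N.subset by blast
qed

text \<open>Each bad lift lies in some member of \<open>supps\<close>, so the combined lift lies in
  the proper subgroup built in \<open>supps_heap\<close>.\<close>

lemma heap_not_gen:
  assumes X: "gen_mod G N X"
    and lift: "\<And>x. x \<in> X \<Longrightarrow> f x \<in> N #> x" "\<And>x. x \<in> X \<Longrightarrow> g x \<in> N #> x" "\<And>x. x \<in> X \<Longrightarrow> h x \<in> N #> x"
    and bad: "\<not> gen_mod G L (f ` X)" "\<not> gen_mod G L (g ` X)" "\<not> gen_mod G L (h ` X)"
  shows "\<not> gen_mod G L ((\<lambda>x. f x \<otimes> inv g x \<otimes> h x) ` X)"
proof -
  have *: "\<exists>K\<in>supps. f ` X \<subseteq> K" if f: "\<And>x. x \<in> X \<Longrightarrow> f x \<in> N #> x" "\<not> gen_mod G L (f ` X)" for f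
  proof (rule supps_not_gen[OF N.gen_mod_cong[OF X] f(2)])
    have "f x \<in> carrier G \<and> N #> f x = N #> x" if "x \<in> X" for x
      using f(1)[OF that] N.mem_rcos_iff gen_modD[OF X] that by blast
    then show "f ` X \<subseteq> carrier G" "\<And>x. x \<in> X \<Longrightarrow> \<exists>y\<in>f ` X. N #> y = N #> x" by auto
  qed
  obtain K1 where K1: "K1 \<in> supps" "f ` X \<subseteq> K1" using *[OF lift(1) bad(1)] by blast
  obtain K2 where K2: "K2 \<in> supps" "g ` X \<subseteq> K2" using *[OF lift(2) bad(2)] by blast
  obtain K3 where K3: "K3 \<in> supps" "h ` X \<subseteq> K3" using *[OF lift(3) bad(3)] by blast
  note K = K1(1) K2(1) K3(1)
  have "N #> f x = N #> g x" "N #> g x = N #> h x" if "x \<in> X" for x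
    using lift[OF that] N.mem_rcos_iff[OF subsetD[OF gen_modD[OF X] that]] by simp_all
  moreover have "f x \<in> K1" "g x \<in> K2" "h x \<in> K3" if "x \<in> X" for x
    using K1(2) K2(2) K3(2) that by auto
  ultimately have "f x \<otimes> inv g x \<otimes> h x \<in> {g1 \<otimes> inv g2 \<otimes> g3 | g1 g2 g3. g1 \<in> K1 \<and> g2 \<in> K2 \<and>
      g3 \<in> K3 \<and> N #> g1 = N #> g2 \<and> N #> g2 = N #> g3}" if "x \<in> X" for x
    using that by blast
  then show ?thesis
    by (intro not_gen_modI[OF supps_heap(1)[OF K] _ supps_heap(3,2)[OF K]] image_subsetI)
qed

end

section \<open>Lifting generating sets\<close>

context chief_factor
begin

lemma lift_simps:
  assumes "X \<subseteq> carrier G" "x \<in> X" "f x \<in> N #> x"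
  shows "f x \<in> carrier G" "N #> f x = N #> x"
  using N.mem_rcos_iff[OF subsetD[OF assms(1,2)]] assms(3) by auto

lemma min_gen_mod_N_imp_L:
  assumes "X \<in> min_gen_mod G N u" "gen_mod G L X"
  shows "X \<in> min_gen_mod G L u"
  using assms gen_mod_N by (auto simp: min_gen_mod_def)

lemma good_lift:
  assumes "X \<in> min_gen_mod G N u" "\<forall>x\<in>X. f x \<in> N #> x" "gen_mod G L (f ` X)"
  shows "f ` X \<in> min_gen_mod G L u"
  using assms min_gen_mod_N_imp_L N.min_gen_mod_lift(1)[of X u f] by blast

text \<open>A proper subgroup containing \<open>X\<close> and \<open>L\<close> would belong to
  \<open>supps\<close> and equal \<open>K\<close> by uniqueness, but \<open>K\<close> misses
  \<open>x\<close>.\<close>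

lemma gen_mod_insert_supp:
  assumes X: "gen_mod G N X" and K: "K \<in> supps" "X \<subseteq> K" and x: "x \<in> carrier G" "x \<notin> K"
  shows "gen_mod G L (insert x X)"
proof (rule gen_modI[OF _ L.subset])
  show "insert x X \<subseteq> carrier G" using gen_modD[OF X] x by blast
  fix H assume H: "subgroup H G" "insert x X \<subseteq> H" "L \<subseteq> H"
  show "H = carrier G"
  proof (rule ccontr)
    assume "H \<noteq> carrier G"
    then have "H \<in> supps" using H supps_gen[OF X] by blast
    then have "H = K" using supps_unique[OF X K] H by blast
    then show False using H x by blast
  qed
qed

text \<open>\<open>X0\<close> is a smallest proper subset of \<open>X\<close> that generates modulo
  \<open>N\<close>. By minimality of \<open>X\<close> it does not generate modulo \<open>L\<close>,
  so it lies in some \<open>K\<close>. Adding one element of \<open>X\<close> outside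
  \<open>K\<close> already generates modulo \<open>L\<close>, so this exhausts
  \<open>X\<close>.\<close>

lemma min_gen_mod_cases:
  assumes X: "X \<in> min_gen_mod G L u" and XN: "X \<notin> min_gen_mod G N u"
  obtains X0 x K where "X = insert x X0" "X0 \<in> min_gen_mod G N (u - 1)" "K \<in> supps" "X0 \<subseteq> K" "u > 0"
proof -
  note gX = min_gen_modD(1)[OF X]
  have finX: "finite X" using finite_subset[OF gen_modD[OF gX] fin] .
  define P where "P Y \<longleftrightarrow> Y \<subset> X \<and> gen_mod G N Y" for Y
  obtain Y where "P Y"
    using XN gen_mod_N[OF gX] min_gen_modD(3)[OF X] by (auto simp: min_gen_mod_def P_def)
  then obtain X0 where X0: "P X0" "\<And>Y. P Y \<Longrightarrow> card X0 \<le> card Y"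
    using ex_has_least_nat[of P Y card] by blast
  have gX0: "gen_mod G N X0" and X0X: "X0 \<subset> X" using X0(1) by (auto simp: P_def)
  have "\<not> gen_mod G N Y" if "Y \<subset> X0" for Y
  proof
    assume "gen_mod G N Y"
    then have "P Y" using that X0X by (auto simp: P_def)
    moreover have "card Y < card X0"
      using that X0X finX by (meson finite_subset psubset_card_mono psubset_imp_subset)
    ultimately show False using X0(2) by fastforce
  qed
  then have M: "X0 \<in> min_gen_mod G N (card X0)" using gX0 by (simp add: min_gen_mod_def)
  obtain K where K: "K \<in> supps" "X0 \<subseteq> K"
    using supps_not_gen[OF gX0] min_gen_modD(4)[OF X X0X] by blast
  have "\<not> X \<subseteq> K" using not_gen_modI[of K X L] suppsD[OF K(1)] gX by blast
  then obtain x where x: "x \<in> X" "x \<notin> K" by blast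
  have "gen_mod G L (insert x X0)"
    using gen_mod_insert_supp[OF gX0 K] x gen_modD[OF gX] by blast
  then have eq: "X = insert x X0" using min_gen_modD(4)[OF X, of "insert x X0"] x X0X by blast
  moreover have "x \<notin> X0" using x K by blast
  ultimately have "u = card X0 + 1" using min_gen_modD(3)[OF X] finX by auto
  then show ?thesis using that[OF eq _ K] M by simp
qed

text \<open>A converse to \<open>min_gen_mod_cases\<close>. Since \<open>n\<close> is trivial modulo
  \<open>N\<close>, a generating subset must contain all of \<open>X\<close>; and \<open>X\<close>
  alone stays inside \<open>K\<close>.\<close>

lemma min_gen_mod_insert:
  assumes X: "X \<in> min_gen_mod G N k" and K: "K \<in> supps" "X \<subseteq> K" and n: "n \<in> N" "n \<notin> L"
  shows "insert n X \<in> min_gen_mod G L (Suc k)"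
proof -
  note gX = min_gen_modD(1)[OF X]
  have nK: "n \<notin> K" using supps_inter[OF K(1)] n by blast
  have nc: "n \<in> carrier G" using n N.subset by blast
  have "finite X" using finite_subset[OF gen_modD[OF gX] fin] .
  moreover have "n \<notin> X" using nK K(2) by blast
  ultimately have "card (insert n X) = Suc k" using min_gen_modD(3)[OF X] by simp
  moreover have "gen_mod G L (insert n X)" by (rule gen_mod_insert_supp[OF gX K nc nK])
  moreover have "\<not> gen_mod G L Y" if Y: "Y \<subset> insert n X" for Y
  proof
    assume gY: "gen_mod G L Y"
    have "gen_mod G N (Y - {n})"
    proof (rule gen_modI[OF _ N.subset])
      fix H assume "subgroup H G" "Y - {n} \<subseteq> H" "N \<subseteq> H"
      then show "H = carrier G" using n by (intro gen_modE[OF gen_mod_N[OF gY]]) auto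
    qed (use gen_modD[OF gY] in blast)
    then have "\<not> Y - {n} \<subset> X" using min_gen_modD(4)[OF X] by blast
    then have "Y = X" using Y by blast
    then show False using gY not_gen_modI[of K X L] suppsD[OF K(1)] K(2) by blast
  qed
  ultimately show ?thesis by (simp add: min_gen_mod_def)
qed

lemma lift_to_supp:
  assumes K: "K \<in> supps" and X: "X \<in> min_gen_mod G N k"
  obtains f where "\<forall>x\<in>X. f x \<in> N #> x" "f ` X \<subseteq> K" "f ` X \<in> min_gen_mod G N k"
proof -
  have "\<forall>x\<in>X. \<exists>y. y \<in> K \<and> N #> y = N #> x"
    using suppsD(5)[OF K] min_gen_modD(2)[OF X] by blast
  then obtain f where f: "\<forall>x\<in>X. f x \<in> K \<and> N #> f x = N #> x" by metis
  have lift: "\<forall>x\<in>X. f x \<in> N #> x"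
  proof
    fix x assume x: "x \<in> X"
    then have "x \<in> carrier G" using min_gen_modD(2)[OF X] by blast
    then show "f x \<in> N #> x" using f x suppsD(4)[OF K] N.mem_rcos_iff[of x "f x"] by auto
  qed
  then have "f ` X \<in> min_gen_mod G N k" using N.min_gen_mod_lift(1)[OF X] by blast
  with lift f that show ?thesis by blast
qed

text \<open>Changing \<open>f\<close> to \<open>g\<close> at \<open>q\<close>, at both
  \<open>q\<close> and \<open>r\<close>, and at \<open>r\<close> gives lifts \<open>?a\<close>,
  \<open>?b\<close>, \<open>?c\<close> with
  \<open>?a x \<otimes> inv (?b x) \<otimes> ?c x = f x\<close> on \<open>X\<close>. By
  \<open>heap_not_gen\<close> they cannot all fail to generate, since \<open>f\<close>
  generates.\<close>

lemma exchange:
  assumes X: "gen_mod G N X" and f: "\<forall>x\<in>X. f x \<in> N #> x" and g: "\<forall>x\<in>X. g x \<in> N #> x"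
    and fX: "gen_mod G L (f ` X)" and qr: "q \<in> X" "r \<in> X" "q \<noteq> r"
  obtains h where "\<forall>x\<in>X. h x \<in> N #> x" "gen_mod G L (h ` X)" "h q = g q \<or> h r = g r"
    "\<And>x. x \<noteq> q \<Longrightarrow> x \<noteq> r \<Longrightarrow> h x = f x"
proof -
  let ?a = "f(q := g q)" and ?b = "f(q := g q, r := g r)" and ?c = "f(r := g r)"
  have l: "\<forall>x\<in>X. ?a x \<in> N #> x" "\<forall>x\<in>X. ?b x \<in> N #> x" "\<forall>x\<in>X. ?c x \<in> N #> x"
    using f g by auto
  have "(\<lambda>x. ?a x \<otimes> inv (?b x) \<otimes> ?c x) ` X = f ` X"
  proof (rule image_cong[OF refl])
    fix x assume x: "x \<in> X"
    then have "f x \<in> carrier G" "g x \<in> carrier G"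
      using lift_simps(1)[OF gen_modD[OF X] x] f g by blast+
    then show "?a x \<otimes> inv (?b x) \<otimes> ?c x = f x" using qr by (auto simp: m_assoc)
  qed
  then have "gen_mod G L (?a ` X) \<or> gen_mod G L (?b ` X) \<or> gen_mod G L (?c ` X)"
    using heap_not_gen[OF X, of ?a ?b ?c] l fX by auto
  then show ?thesis
  proof (elim disjE)
    assume "gen_mod G L (?a ` X)" then show ?thesis using l by (intro that[of ?a]) auto
  next
    assume "gen_mod G L (?b ` X)" then show ?thesis using l qr by (intro that[of ?b]) auto
  next
    assume "gen_mod G L (?c ` X)" then show ?thesis using l qr by (intro that[of ?c]) auto
  qed
qed

text \<open>The criterion of \<open>lift_count\<close> involves only \<open>T\<close> and the number
  of elements to be lifted.\<close>

lemma lift_transfer: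
  assumes X: "finite X" "gen_mod G N (T \<union> X)" and Y: "finite Y" "gen_mod G N (T \<union> Y)"
    and card: "card X = card Y"
    and f: "\<forall>x\<in>X. f x \<in> N #> x" "gen_mod G L (T \<union> f ` X)"
  shows "\<exists>g. (\<forall>y\<in>Y. g y \<in> N #> y) \<and> gen_mod G L (T \<union> g ` Y)"
proof -
  have "\<exists>f. (\<forall>x\<in>X. f x \<in> N #> x) \<and> gen_mod G L (T \<union> f ` X)" using f by blast
  then show ?thesis
    unfolding lift_count(1)[OF X(1) gen_modD[OF X(2)] X(2)]
      lift_count(1)[OF Y(1) gen_modD[OF Y(2)] Y(2)] card .
qed

lemma gen_mod_replace:
  assumes X: "X \<in> min_gen_mod G N u" "z \<in> X" and w: "w \<in> carrier G" "N #> w = N #> z"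
  shows "gen_mod G N ({w} \<union> (X - {z}))"
proof (rule N.gen_mod_cong[OF min_gen_modD(1)[OF X(1)]])
  show "{w} \<union> (X - {z}) \<subseteq> carrier G" using w min_gen_modD(2)[OF X(1)] by blast
  show "\<exists>y\<in>{w} \<union> (X - {z}). N #> y = N #> x" if "x \<in> X" for x
    using that w by (cases "x = z") auto
qed

lemma finite_min_gen_mod: "X \<in> min_gen_mod G M u \<Longrightarrow> finite X"
  using fin min_gen_modD(2) finite_subset by metis

text \<open>\<open>Z\<close> serves as the first generating lift. \<open>lift_transfer\<close> with
  \<open>T = {}\<close> passes it on to \<open>X\<close>; then with \<open>T = {f x}\<close>, where
  \<open>f x\<close> represents both \<open>x\<close> and \<open>y\<close> modulo \<open>N\<close>,
  it passes the rest of the lift of \<open>X\<close> on to \<open>Y\<close>.\<close>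

lemma common_lift:
  assumes Z: "Z \<in> min_gen_mod G N u" "gen_mod G L Z"
    and X: "X \<in> min_gen_mod G N u" "x \<in> X" and Y: "Y \<in> min_gen_mod G N u" "y \<in> Y"
    and xy: "N #> x = N #> y"
  obtains f g where "\<forall>x\<in>X. f x \<in> N #> x" "gen_mod G L (f ` X)"
    "\<forall>x\<in>Y. g x \<in> N #> x" "gen_mod G L (g ` Y)" "f x = g y"
proof -
  have fi: "finite X" "finite Y" "finite Z" using finite_min_gen_mod X Y Z by auto
  have c: "card X = u" "card Y = u" "card Z = u" using min_gen_modD(3) X(1) Y(1) Z(1) by auto
  have zz: "\<forall>z\<in>Z. id z \<in> N #> z"
    using rcos_self[OF _ N.subgroup_axioms] min_gen_modD(2)[OF Z(1)] by auto
  have "\<exists>f. (\<forall>y\<in>X. f y \<in> N #> y) \<and> gen_mod G L ({} \<union> f ` X)"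
    using lift_transfer[of Z "{}" X id] fi zz min_gen_modD(1)[OF X(1)] min_gen_modD(1)[OF Z(1)] Z(2) c
    by simp
  then obtain f where f: "\<forall>x\<in>X. f x \<in> N #> x" "gen_mod G L (f ` X)" by auto
  have fx: "f x \<in> carrier G" "N #> f x = N #> x"
    using lift_simps[OF min_gen_modD(2)[OF X(1)] X(2)] f(1) X(2) by auto
  have "{f x} \<union> f ` (X - {x}) = f ` X" using X(2) by auto
  then have "\<exists>g. (\<forall>y\<in>Y - {y}. g y \<in> N #> y) \<and> gen_mod G L ({f x} \<union> g ` (Y - {y}))"
    using lift_transfer[of "X - {x}" "{f x}" "Y - {y}" f] fi c f X(2) Y(2) fx xy
      gen_mod_replace[OF X fx] gen_mod_replace[OF Y fx(1)] by simp
  then obtain g where g: "\<forall>w\<in>Y - {y}. g w \<in> N #> w" "gen_mod G L ({f x} \<union> g ` (Y - {y}))" by auto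
  define g' where "g' = g(y := f x)"
  have "{f x} \<union> g ` (Y - {y}) = g' ` Y" using Y(2) by (auto simp: g'_def)
  moreover have "f x \<in> N #> y"
    using fx xy N.mem_rcos_iff[of y] min_gen_modD(2)[OF Y(1)] Y(2) by auto
  then have "\<forall>w\<in>Y. g' w \<in> N #> w" using g(1) by (auto simp: g'_def)
  moreover have "f x = g' y" by (simp add: g'_def)
  ultimately show ?thesis using that[OF f, of g'] g(2) by simp
qed

section \<open>Lifting chains, and linking the generating lifts of one set\<close>

lemma good_lift_link:
  assumes "X \<in> min_gen_mod G N u" "\<forall>x\<in>X. f x \<in> N #> x" "gen_mod G L (f ` X)" "x \<in> X" "y \<in> X"
  shows "(f x, f y) \<in> (link G L u)\<^sup>*"
  using min_gen_mod_link[OF good_lift[OF assms(1-3)]] assms(4,5) by blast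

text \<open>Induction along the path modulo \<open>N\<close>: consecutive sets have generating lifts
  that meet (\<open>common_lift\<close>), and \<open>same\<close> connects different generating
  lifts of one set. The endpoint is fixed only up to congruence modulo \<open>N\<close>, so that the
  congruence steps of \<open>link\<close> are absorbed.\<close>

lemma chain_lift:
  assumes same: "\<And>X f g x y. X \<in> min_gen_mod G N u \<Longrightarrow> \<forall>x\<in>X. f x \<in> N #> x \<Longrightarrow> \<forall>x\<in>X. g x \<in> N #> x \<Longrightarrow>
      gen_mod G L (f ` X) \<Longrightarrow> gen_mod G L (g ` X) \<Longrightarrow> x \<in> X \<Longrightarrow> y \<in> X \<Longrightarrow>
      (f x, g y) \<in> (link G L u)\<^sup>*"
    and X: "X \<in> min_gen_mod G N u" "gen_mod G L X" "a \<in> X"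
    and path: "(a, y) \<in> (link G N u)\<^sup>*"
    and Y: "Y \<in> min_gen_mod G N u" "y' \<in> Y" "N #> y' = N #> y"
    and g: "\<forall>x\<in>Y. g x \<in> N #> x" "gen_mod G L (g ` Y)" and w: "w \<in> Y"
  shows "(a, g w) \<in> (link G L u)\<^sup>*"
  using path Y g w
proof (induction arbitrary: Y y' g w rule: rtrancl_induct)
  case base
  obtain f h where fh: "\<forall>x\<in>X. f x \<in> N #> x" "gen_mod G L (f ` X)"
    "\<forall>x\<in>Y. h x \<in> N #> x" "gen_mod G L (h ` Y)" "f a = h y'"
    using common_lift[OF X(1,2) X(1,3) base(1,2)] base(3) by metis
  have "\<forall>x\<in>X. id x \<in> N #> x"
    using rcos_self[OF _ N.subgroup_axioms] min_gen_modD(2)[OF X(1)] by auto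
  then have "(id a, f a) \<in> (link G L u)\<^sup>*"
    using X fh by (intro same[OF X(1)]) auto
  moreover have "(h y', g w) \<in> (link G L u)\<^sup>*" using base fh by (intro same[OF base(1)]) auto
  ultimately show ?case using fh(5) by simp
next
  case (step y z)
  show ?case
  proof (cases "\<exists>Z\<in>min_gen_mod G N u. y \<in> Z \<and> z \<in> Z")
    case True
    then obtain Z where Z: "Z \<in> min_gen_mod G N u" "y \<in> Z" "z \<in> Z" by blast
    obtain f h where fh: "\<forall>x\<in>Z. f x \<in> N #> x" "gen_mod G L (f ` Z)"
      "\<forall>x\<in>Y. h x \<in> N #> x" "gen_mod G L (h ` Y)" "f z = h y'"
      using common_lift[OF X(1,2) Z(1,3) step.prems(1,2)] step.prems(3) by metis
    have "(a, f z) \<in> (link G L u)\<^sup>*" using step.IH[OF Z(1,2) refl fh(1,2) Z(3)] .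
    moreover have "(h y', g w) \<in> (link G L u)\<^sup>*"
      using step.prems fh by (intro same[OF step.prems(1)]) auto
    ultimately show ?thesis using fh(5) by simp
  next
    case False
    then have "N #> y = N #> z" using step.hyps(2) by (auto simp: link_def)
    then show ?thesis using step.IH[OF step.prems(1,2)] step.prems by simp
  qed
qed

text \<open>A third element \<open>p\<close> stays fixed while \<open>exchange\<close> works at
  \<open>q\<close> and \<open>r\<close>: the intermediate lift \<open>h\<close> shares its value at
  \<open>p\<close> with \<open>f\<close>, and its value at \<open>q\<close> or \<open>r\<close> with
  \<open>g\<close>.\<close>

lemma same_lifts_3:
  assumes X: "X \<in> min_gen_mod G N u" and u: "u \<ge> 3"
    and f: "\<forall>x\<in>X. f x \<in> N #> x" "gen_mod G L (f ` X)"
    and g: "\<forall>x\<in>X. g x \<in> N #> x" "gen_mod G L (g ` X)"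
    and xy: "x \<in> X" "y \<in> X"
  shows "(f x, g y) \<in> (link G L u)\<^sup>*"
proof -
  have "3 \<le> card X" using u min_gen_modD(3)[OF X] by simp
  then obtain S where "S \<subseteq> X" "card S = 3" using obtain_subset_with_card_n by metis
  then obtain p q r where pqr: "p \<in> X" "q \<in> X" "r \<in> X" "p \<noteq> q" "p \<noteq> r" "q \<noteq> r"
    by (auto simp: card_3_iff)
  obtain h where h: "\<forall>x\<in>X. h x \<in> N #> x" "gen_mod G L (h ` X)" "h q = g q \<or> h r = g r"
    "\<And>x. x \<noteq> q \<Longrightarrow> x \<noteq> r \<Longrightarrow> h x = f x"
    using exchange[OF min_gen_modD(1)[OF X] f(1) g(1) f(2) pqr(2,3,6)] by metis
  then obtain s where s: "s \<in> X" "h s = g s" using pqr by blast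
  have "(f x, h p) \<in> (link G L u)\<^sup>*"
    using good_lift_link[OF X f xy(1) pqr(1)] h(4)[OF pqr(4,5)] by simp
  also have "(h p, g s) \<in> (link G L u)\<^sup>*"
    using good_lift_link[OF X h(1,2) pqr(1) s(1)] s by simp
  also have "(g s, g y) \<in> (link G L u)\<^sup>*" using good_lift_link[OF X g s(1) xy(2)] .
  finally show ?thesis .
qed

text \<open>Without complements every lift generates, so a lift that mixes values of
  \<open>f\<close> and \<open>g\<close> connects the two.\<close>

lemma same_lifts_no_supps:
  assumes X: "X \<in> min_gen_mod G N u" and u: "u \<ge> 2" and no: "supps = {}"
    and f: "\<forall>x\<in>X. f x \<in> N #> x" and g: "\<forall>x\<in>X. g x \<in> N #> x"
    and xy: "x \<in> X" "y \<in> X"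
  shows "(f x, g y) \<in> (link G L u)\<^sup>*"
proof -
  have "2 \<le> card X" using u min_gen_modD(3)[OF X] by simp
  then obtain S where "S \<subseteq> X" "card S = 2" using obtain_subset_with_card_n by metis
  then obtain p q where pq: "p \<in> X" "q \<in> X" "p \<noteq> q" by (auto simp: card_2_iff)
  have good: "gen_mod G L (h ` X)" if h: "\<forall>x\<in>X. h x \<in> N #> x" for h
    using supps_not_gen[OF min_gen_modD(1)[OF N.min_gen_mod_lift(1)[OF X]], of h] h no by blast
  let ?h = "f(q := g q)"
  have h: "\<forall>x\<in>X. ?h x \<in> N #> x" using f g by auto
  have "(f x, ?h p) \<in> (link G L u)\<^sup>*"
    using good_lift_link[OF X f good[OF f] xy(1) pq(1)] pq(3) by simp
  also have "(?h p, ?h q) \<in> (link G L u)\<^sup>*" by (rule good_lift_link[OF X h good[OF h] pq(1,2)])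
  also have "(?h q, g y) \<in> (link G L u)\<^sup>*"
    using good_lift_link[OF X g good[OF g] pq(2) xy(2)] by simp
  finally show ?thesis .
qed

text \<open>As no single element generates modulo \<open>N\<close>, a generating pair modulo
  \<open>L\<close> is automatically minimal.\<close>

lemma pair_link:
  assumes no1: "\<And>z. \<not> gen_mod G N {z}" and pq: "gen_mod G L {p, q}"
  shows "(p, q) \<in> link G L 2"
proof -
  have "p \<noteq> q" using no1[of p] gen_mod_N[OF pq] by auto
  moreover have "\<not> gen_mod G L Y" if Ypq: "Y \<subset> {p, q}" for Y
  proof
    assume Y: "gen_mod G L Y"
    obtain z where z: "Y \<subseteq> {z}" "z \<in> {p, q}" using Ypq by blast
    then have "{z} \<subseteq> carrier G" using gen_modD[OF pq] by blast
    then have "gen_mod G N {z}"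
      using gen_mod_mono[OF gen_mod_N[OF Y] z(1) subset_refl _ N.subset] by blast
    then show False using no1 by blast
  qed
  ultimately have "{p, q} \<in> min_gen_mod G L 2" using pq by (simp add: min_gen_mod_def)
  then show ?thesis unfolding link_def by blast
qed

text \<open>If \<open>a\<close> and \<open>b\<close> are not linked, a lift of \<open>x\<close> not
  linked to \<open>a\<close> has in \<open>N #> y\<close> exactly those bad partners that
  \<open>a\<close> lacks; likewise for \<open>b\<close>. The move
  \<open>(p, c) \<mapsto> (p, p \<otimes> c)\<close> makes the bad set invariant under left
  multiplication by quotients of unlinked elements, and these yield all of \<open>N\<close>. As
  \<open>N\<close> is transitive on \<open>N #> y\<close>, the bad set of \<open>a\<close> is empty
  or everything; but it omits \<open>ca\<close> and contains \<open>cb\<close>.\<close>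

lemma nielsen:
  assumes no1: "\<And>z. \<not> gen_mod G N {z}" and X: "gen_mod G N {x, y}"
    and a: "a \<in> N #> x" and ca: "ca \<in> N #> y" "gen_mod G L {a, ca}"
    and b: "b \<in> N #> x" and cb: "cb \<in> N #> y" "gen_mod G L {b, cb}"
  shows "(a, b) \<in> (link G L 2)\<^sup>*"
proof (rule ccontr)
  let ?R = "(link G L 2)\<^sup>*"
  assume ab: "(a, b) \<notin> ?R"
  define A where "A p = {c \<in> N #> y. \<not> gen_mod G L {p, c}}" for p
  have xy: "x \<in> carrier G" "y \<in> carrier G" using gen_modD[OF X] by auto
  have "x \<noteq> y" using no1[of x] X by auto
  have xc: "p \<in> carrier G" if "p \<in> N #> x" for p using that N.mem_rcos_iff[OF xy(1)] by blast
  have yc: "c \<in> carrier G" if "c \<in> N #> y" for c using that N.mem_rcos_iff[OF xy(2)] by blast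
  have Ac: "A p \<subseteq> N #> y" for p by (auto simp: A_def)
  have quot: "inv q \<otimes> p \<in> N" if "p \<in> N #> x" "q \<in> N #> x" for p q
  proof -
    have "N #> (inv q \<otimes> p) = N #> (inv q \<otimes> q)"
      using that N.mem_rcos_iff[OF xy(1)] by (intro N.rcos_mult_cong) auto
    then show ?thesis
      using rcos_self[OF _ N.subgroup_axioms, of "inv q \<otimes> p"] xc that N.subset by simp
  qed
  have trans: "n \<otimes> c \<in> N #> y" if n: "n \<in> N" and c: "c \<in> N #> y" for n c
  proof -
    have nc: "n \<in> carrier G" using n N.subset by blast
    have "n \<otimes> c \<otimes> inv c \<in> N" using n nc yc[OF c] by (simp add: m_assoc)
    then have "N #> (n \<otimes> c) = N #> c" using N.rcos_eq_iff nc yc[OF c] by simp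
    then show ?thesis using c nc N.mem_rcos_iff[OF xy(2)] by simp
  qed
  have pair: "gen_mod G L {p, p \<otimes> c}" if "gen_mod G L {p, c}" for p c
  proof (rule gen_modI[OF _ L.subset])
    have pc: "p \<in> carrier G" "c \<in> carrier G" using gen_modD[OF that] by auto
    then show "{p, p \<otimes> c} \<subseteq> carrier G" by simp
    fix H assume H: "subgroup H G" "{p, p \<otimes> c} \<subseteq> H" "L \<subseteq> H"
    then have "inv p \<otimes> (p \<otimes> c) \<in> H"
      by (intro subgroup.m_closed[OF H(1) subgroup.m_inv_closed[OF H(1)]]) auto
    then have "c \<in> H" using pc by (simp add: m_assoc[symmetric])
    then show "H = carrier G" using H by (intro gen_modE[OF that]) auto
  qed
  have near: "c \<in> A p \<or> c \<in> A q" if "(p, q) \<notin> ?R" "c \<in> N #> y" for p q c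
  proof (rule ccontr)
    assume "\<not> (c \<in> A p \<or> c \<in> A q)"
    then have "(p, c) \<in> link G L 2" "(q, c) \<in> link G L 2"
      using that(2) pair_link[OF no1] by (auto simp: A_def)
    then have "(p, q) \<in> ?R"
      using sym_link[of G L 2] by (meson r_into_rtrancl rtrancl_trans symD)
    then show False using that by blast
  qed
  \<comment> \<open>The common neighbour of \<open>p\<close> and \<open>q\<close> is here the element \<open>p \<otimes> c\<close>.\<close>
  have near_mult: "c \<in> A p \<or> inv q \<otimes> p \<otimes> c \<in> A q"
    if "(p, q) \<notin> ?R" "c \<in> N #> y" "p \<in> N #> x" "q \<in> N #> x" for p q c
  proof (rule ccontr)
    assume *: "\<not> (c \<in> A p \<or> inv q \<otimes> p \<otimes> c \<in> A q)"
    have "inv q \<otimes> p \<otimes> c \<in> N #> y" by (rule trans[OF quot[OF that(3,4)] that(2)])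
    then have "gen_mod G L {p, c}" "gen_mod G L {q, inv q \<otimes> p \<otimes> c}"
      using * that(2) by (auto simp: A_def)
    then have "gen_mod G L {p, p \<otimes> c}" "gen_mod G L {q, q \<otimes> (inv q \<otimes> p \<otimes> c)}"
      using pair by auto
    moreover have "q \<otimes> (inv q \<otimes> p \<otimes> c) = p \<otimes> c"
      using xc[OF that(3)] xc[OF that(4)] yc[OF that(2)] by (simp add: m_assoc[symmetric])
    ultimately have "(p, p \<otimes> c) \<in> link G L 2" "(q, p \<otimes> c) \<in> link G L 2"
      using pair_link[OF no1] by auto
    then have "(p, q) \<in> ?R"
      using sym_link[of G L 2] by (meson r_into_rtrancl rtrancl_trans symD)
    then show False using that by blast
  qed
  have disj: "A p = (N #> y) - A e"
    if pe: "(p, e) \<notin> ?R" and p: "p \<in> N #> x" and e: "e \<in> N #> x"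
      and c: "c \<in> N #> y" "gen_mod G L {e, c}" for p e c
  proof -
    \<comment> \<open>A common bad partner \<open>c0\<close> is excluded by combining the three bad
      pairs \<open>(e, c0)\<close>, \<open>(p, c0)\<close>, \<open>(p, c)\<close> to the good pair
      \<open>(e, c)\<close>.\<close>
    have "False" if c0: "c0 \<in> A p" "c0 \<in> A e" for c0
    proof -
      have "c \<notin> A e" using c by (auto simp: A_def)
      then have cp: "c \<in> A p" using near[OF pe c(1)] by blast
      let ?f = "\<lambda>z. if z = x then e else c0"
        and ?g = "\<lambda>z. if z = x then p else c0" and ?h = "\<lambda>z. if z = x then p else c"
      have "\<not> gen_mod G L ((\<lambda>z. ?f z \<otimes> inv (?g z) \<otimes> ?h z) ` {x, y})"
        using c0 cp p e c(1) \<open>x \<noteq> y\<close> Ac by (intro heap_not_gen[OF X]) (auto simp: A_def insert_commute)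
      moreover have "(\<lambda>z. ?f z \<otimes> inv (?g z) \<otimes> ?h z) ` {x, y} = {e, c}"
      proof -
        have "e \<otimes> inv p \<otimes> p = e" using xc[OF p] xc[OF e] by (simp add: m_assoc)
        moreover have "c0 \<otimes> inv c0 \<otimes> c = c" using yc[OF c(1)] yc[OF subsetD[OF Ac c0(1)]] by simp
        ultimately show ?thesis using \<open>x \<noteq> y\<close> by simp
      qed
      ultimately show False using c(2) by simp
    qed
    then show ?thesis using near[OF pe] Ac by blast
  qed
  \<comment> \<open>The stabiliser of \<open>B\<close> in \<open>N\<close>, acting by left
    multiplication on \<open>N #> y\<close>.\<close>
  define S where "S B = {n \<in> N. \<forall>c\<in>N #> y. n \<otimes> c \<in> B \<longleftrightarrow> c \<in> B}" for B
  have stab: "inv e \<otimes> p \<in> S (A e)"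
    if pe: "(p, e) \<notin> ?R" and p: "p \<in> N #> x" and e: "e \<in> N #> x"
      and c: "c \<in> N #> y" "gen_mod G L {e, c}" for p e c
  proof -
    let ?t = "inv e \<otimes> p"
    have t: "?t \<in> N" by (rule quot[OF p e])
    have tc: "?t \<in> carrier G" using t N.subset by blast
    have cl: "?t \<otimes> c \<in> A e" if "c \<in> A e" for c
      using near_mult[OF pe _ p e, of c] disj[OF pe p e c] that Ac by blast
    \<comment> \<open>By finiteness the inclusion is an equality, which gives the reverse
      implication in the definition of \<open>S\<close>.\<close>
    have im: "(\<lambda>c. ?t \<otimes> c) ` A e = A e"
    proof (rule endo_inj_surj)
      have "A e \<subseteq> carrier G" using Ac yc by blast
      then show "finite (A e)" using fin by (rule finite_subset)
      show "inj_on (\<lambda>c. ?t \<otimes> c) (A e)"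
        using \<open>A e \<subseteq> carrier G\<close> tc by (intro inj_onI) (metis Units_eq Units_l_cancel subsetD)
      show "(\<lambda>c. ?t \<otimes> c) ` A e \<subseteq> A e" using cl by blast
    qed
    have "c \<in> A e" if c: "?t \<otimes> c \<in> A e" "c \<in> N #> y" for c
    proof -
      obtain c' where c': "c' \<in> A e" "?t \<otimes> c = ?t \<otimes> c'"
        using c(1) im imageE[of "?t \<otimes> c" "\<lambda>c. ?t \<otimes> c" "A e"] by auto
      then have "c = c'" using Units_l_cancel[of ?t c c'] tc yc[OF c(2)] yc[OF subsetD[OF Ac c'(1)]] by auto
      then show ?thesis using c'(1) by simp
    qed
    then have "\<forall>c\<in>N #> y. ?t \<otimes> c \<in> A e \<longleftrightarrow> c \<in> A e" using cl by blast
    then show ?thesis using t unfolding S_def by blast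
  qed
  have ba: "(b, a) \<notin> ?R" using ab link_rtrancl_sym by metis
  have Ab: "A b = (N #> y) - A a" by (rule disj[OF ba b a ca])
  \<comment> \<open>A set and its complement in \<open>N #> y\<close> have the same
    stabiliser.\<close>
  have Sb: "S (A b) = S (A a)" unfolding Ab S_def using trans by blast
  have Smult: "m \<otimes> n \<in> S B" if "m \<in> S B" "n \<in> S B" for m n B
  proof -
    have "m \<otimes> n \<otimes> c = m \<otimes> (n \<otimes> c)" if "c \<in> N #> y" for c
      using \<open>m \<in> S B\<close> \<open>n \<in> S B\<close> yc[OF that] N.subset by (intro m_assoc) (auto simp: S_def)
    then show ?thesis using that trans by (auto simp: S_def N.m_closed)
  qed
  have all: "n \<in> S (A a)" if n: "n \<in> N" for n
  proof -
    have nc: "n \<in> carrier G" using n N.subset by blast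
    have "N #> (a \<otimes> n) = N #> (a \<otimes> \<one>)"
      using n nc xc[OF a] N.rcos_const[OF is_group n] N.subset by (intro N.rcos_mult_cong) auto
    then have p: "a \<otimes> n \<in> N #> x" using a nc N.mem_rcos_iff[OF xy(1)] by simp
    have n_eq: "n = inv a \<otimes> (a \<otimes> n)" using xc[OF a] nc by (simp add: m_assoc[symmetric])
    show ?thesis
    proof (cases "(a \<otimes> n, a) \<in> ?R")
      case False
      then show ?thesis using stab[OF False p a ca] n_eq by simp
    next
      \<comment> \<open>Here \<open>a \<otimes> n\<close> is linked to \<open>a\<close>, hence not
        to \<open>b\<close>, and \<open>n\<close> is a product of two stabilising quotients that
        passes through \<open>b\<close>.\<close>
      case True
      then have pb: "(a \<otimes> n, b) \<notin> ?R" using ab link_rtrancl_sym rtrancl_trans by metis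
      have "(inv a \<otimes> b) \<otimes> (inv b \<otimes> (a \<otimes> n)) \<in> S (A a)"
        using Smult[OF stab[OF ba b a ca]] stab[OF pb p b cb] Sb by simp
      moreover have "(inv a \<otimes> b) \<otimes> (inv b \<otimes> (a \<otimes> n)) = n"
      proof -
        have "b \<otimes> (inv b \<otimes> (a \<otimes> n)) = a \<otimes> n"
          using xc[OF a] xc[OF b] nc m_assoc[of b "inv b" "a \<otimes> n"] by simp
        moreover have "(inv a \<otimes> b) \<otimes> (inv b \<otimes> (a \<otimes> n)) = inv a \<otimes> (b \<otimes> (inv b \<otimes> (a \<otimes> n)))"
          using xc[OF a] xc[OF b] nc by (intro m_assoc) auto
        ultimately show ?thesis using n_eq by simp
      qed
      ultimately show ?thesis by (simp only:)
    qed
  qed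
  have 1: "ca \<in> N #> y" "ca \<notin> A a" using ca by (auto simp: A_def)
  have 2: "cb \<in> N #> y" "cb \<in> A a" using cb Ab by (auto simp: A_def)
  have "cb \<otimes> inv ca \<in> N"
    using N.rcos_eq_iff[OF yc[OF 2(1)] yc[OF 1(1)]] 1(1) 2(1) N.mem_rcos_iff[OF xy(2)] by simp
  then have "cb \<otimes> inv ca \<in> S (A a)" by (rule all)
  then have "cb \<otimes> inv ca \<otimes> ca \<in> A a \<longleftrightarrow> ca \<in> A a" using 1(1) unfolding S_def by blast
  moreover have "cb \<otimes> inv ca \<otimes> ca = cb" using yc[OF 1(1)] yc[OF 2(1)] by (simp add: m_assoc)
  ultimately show False using 1 2 by simp
qed

lemma same_lifts_2:
  assumes X: "X \<in> min_gen_mod G N 2" and no1: "min_gen_mod G N 1 = {}"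
    and f: "\<forall>x\<in>X. f x \<in> N #> x" "gen_mod G L (f ` X)"
    and g: "\<forall>x\<in>X. g x \<in> N #> x" "gen_mod G L (g ` X)"
    and xy: "x \<in> X" "y \<in> X"
  shows "(f x, g y) \<in> (link G L 2)\<^sup>*"
proof -
  have "card X = 2" by (rule min_gen_modD(3)[OF X])
  then obtain z where z: "X = {x, z}" "z \<noteq> x" using xy(1) by (auto simp: card_2_iff)
  have "\<not> gen_mod G N {}" using min_gen_modD(4)[OF X, of "{}"] z by blast
  then have no: "\<not> gen_mod G N {w}" for w
  proof -
    have "\<not> gen_mod G N Y" if "Y \<subset> {w}" for Y
      using that \<open>\<not> gen_mod G N {}\<close> by (metis psubset_eq subset_singletonD)
    moreover have "{w} \<notin> min_gen_mod G N 1" using no1 by blast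
    ultimately show ?thesis by (auto simp: min_gen_mod_def)
  qed
  have "(f x, g x) \<in> (link G L 2)\<^sup>*"
    using nielsen[OF no, of x z "f x" "f z" "g x" "g z"] min_gen_modD(1)[OF X] f g z by auto
  also have "(g x, g y) \<in> (link G L 2)\<^sup>*" by (rule good_lift_link[OF X g xy])
  finally show ?thesis .
qed

end

section \<open>Descent along a chief series\<close>

text \<open>In the descent this provides, for \<open>u \<ge> 3\<close>, a set arising by lifting and a set arising by adding
  an element of \<open>N - L\<close> that have an element in common.\<close>

definition adjacent_sizes :: "('a, 'b) monoid_scheme \<Rightarrow> 'a set \<Rightarrow> bool" where
  "adjacent_sizes G L \<longleftrightarrow> (\<forall>c d. d < c \<longrightarrow> min_gen_mod G L c \<noteq> {} \<longrightarrow> min_gen_mod G L d \<noteq> {} \<longrightarrow>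
     (\<exists>X\<in>min_gen_mod G L c. \<exists>Y\<in>min_gen_mod G L (c - 1). 3 \<le> c \<longrightarrow> X \<inter> Y \<noteq> {}))"

definition link_connected :: "('a, 'b) monoid_scheme \<Rightarrow> 'a set \<Rightarrow> nat \<Rightarrow> bool" where
  "link_connected G L u \<longleftrightarrow> (\<forall>X\<in>min_gen_mod G L u. \<forall>Y\<in>min_gen_mod G L u. \<forall>x\<in>X. \<forall>y\<in>Y.
     (x, y) \<in> (link G L u)\<^sup>*)"

context chief_factor
begin

text \<open>Given a complement \<open>K\<close>, adding \<open>n\<close> to a lift inside
  \<open>K\<close> turns size \<open>k\<close> modulo \<open>N\<close> into size
  \<open>k + 1\<close> modulo \<open>L\<close>, and two sets made this way share \<open>n\<close>.
  When no set of size \<open>c - 1\<close> arises so, \<open>D\<close> itself has that size and is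
  minimal modulo \<open>N\<close>; \<open>exchange\<close> then moves it until it meets a lift
  inside \<open>K\<close>.\<close>

lemma adjacent_sizes_step:
  assumes IH: "adjacent_sizes G N"
  shows "adjacent_sizes G L"
  unfolding adjacent_sizes_def
proof (intro allI impI)
  note IH = IH[unfolded adjacent_sizes_def, rule_format]
  fix c d assume dc: "d < c" and "min_gen_mod G L c \<noteq> {}" "min_gen_mod G L d \<noteq> {}"
  then obtain X D where X: "X \<in> min_gen_mod G L c" and D: "D \<in> min_gen_mod G L d" by blast
  show "\<exists>X\<in>min_gen_mod G L c. \<exists>Y\<in>min_gen_mod G L (c - 1). 3 \<le> c \<longrightarrow> X \<inter> Y \<noteq> {}"
  proof (cases "supps = {}")
    case True
    then have "gen_mod G L Y \<longleftrightarrow> gen_mod G N Y" for Y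
      using supps_not_gen gen_mod_N by blast
    then have "min_gen_mod G L = min_gen_mod G N" by (simp add: min_gen_mod_def fun_eq_iff)
    then show ?thesis using IH[OF dc] X D by auto
  next
    case False
    then obtain K where K: "K \<in> supps" by blast
    obtain n where n: "n \<in> N" "n \<notin> L" using less by blast
    have typeB: "\<exists>f. (\<forall>x\<in>Z. f x \<in> N #> x) \<and> f ` Z \<subseteq> K \<and> insert n (f ` Z) \<in> min_gen_mod G L (Suc k)"
      if "Z \<in> min_gen_mod G N k" for Z k
      using lift_to_supp[OF K that] min_gen_mod_insert[OF _ K _ n] by metis
    have dN: "D \<in> min_gen_mod G N d \<or> (min_gen_mod G N (d - 1) \<noteq> {} \<and> 0 < d)"
      using min_gen_mod_cases[OF D] by blast
    \<comment> \<open>If \<open>X\<close> is still minimal modulo \<open>N\<close>, the induction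
      hypothesis applies to it and the smaller size coming from \<open>D\<close>; otherwise one
      element of \<open>X\<close> is dropped.\<close>
    have "min_gen_mod G N (c - 1) \<noteq> {}"
    proof (cases "X \<in> min_gen_mod G N c")
      case True
      obtain d' where "d' < c" "min_gen_mod G N d' \<noteq> {}" using dN dc less_imp_diff_less by blast
      then show ?thesis using IH[of d' c] True by blast
    qed (use min_gen_mod_cases[OF X] in blast)
    then obtain Z where Z: "Z \<in> min_gen_mod G N (c - 1)" by blast
    obtain f where f: "\<forall>x\<in>Z. f x \<in> N #> x" "f ` Z \<subseteq> K" "insert n (f ` Z) \<in> min_gen_mod G L c"
      using typeB[OF Z] dc by auto
    show ?thesis
    proof (cases "2 \<le> c \<and> min_gen_mod G N (c - 2) \<noteq> {}")
      case True
      then obtain W where W: "W \<in> min_gen_mod G N (c - 2)" by blast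
      have c: "Suc (c - 2) = c - 1" using True by arith
      obtain g where "insert n (g ` W) \<in> min_gen_mod G L (c - 1)" using typeB[OF W] unfolding c by blast
      then have "insert n (f ` Z) \<inter> insert n (g ` W) \<noteq> {}"
        "insert n (g ` W) \<in> min_gen_mod G L (c - 1)" by auto
      then show ?thesis using f(3) by metis
    next
      case False
      have DN: "D \<in> min_gen_mod G N (c - 1)" "d = c - 1"
      proof -
        \<comment> \<open>A size below \<open>c - 1\<close> would, by the induction hypothesis,
          produce size \<open>c - 2\<close>.\<close>
        have no: "min_gen_mod G N d' = {}" if "d' < c - 1" for d'
        proof (rule ccontr)
          assume "min_gen_mod G N d' \<noteq> {}"
          then have "min_gen_mod G N (c - 1 - 1) \<noteq> {}" using IH[OF that] Z by blast
          moreover have "2 \<le> c" "c - 1 - 1 = c - 2" using that by auto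
          ultimately show False using False by auto
        qed
        have "\<not> d < c - 1"
        proof
          assume "d < c - 1"
          moreover from this have "d - 1 < c - 1" by simp
          ultimately show False using dN no[of d] no[of "d - 1"] by blast
        qed
        then show d: "d = c - 1" using dc by simp
        show "D \<in> min_gen_mod G N (c - 1)" using dN no[of "d - 1"] d by auto
      qed
      show ?thesis
      proof (cases "3 \<le> c")
        case c3: True
        obtain h where h: "\<forall>x\<in>D. h x \<in> N #> x" "insert n (h ` D) \<in> min_gen_mod G L c"
          using typeB[OF DN(1)] c3 by auto
        have "2 \<le> card D" using c3 min_gen_modD(3)[OF DN(1)] by simp
        then obtain S where "S \<subseteq> D" "card S = 2" using obtain_subset_with_card_n by metis
        then obtain q r where qr: "q \<in> D" "r \<in> D" "q \<noteq> r" by (auto simp: card_2_iff)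
        have "\<forall>x\<in>D. id x \<in> N #> x" "gen_mod G L (id ` D)"
          using rcos_self[OF _ N.subgroup_axioms] min_gen_modD(1,2)[OF D] by auto
        then obtain e where e: "\<forall>x\<in>D. e x \<in> N #> x" "gen_mod G L (e ` D)" "e q = h q \<or> e r = h r"
          using exchange[OF min_gen_modD(1)[OF DN(1)] _ h(1) _ qr, of id] by metis
        have eD: "e ` D \<in> min_gen_mod G L (c - 1)" by (rule good_lift[OF DN(1) e(1,2)])
        have "insert n (h ` D) \<inter> e ` D \<noteq> {}"
          using e(3)
        proof
          assume eh: "e q = h q"
          have "e q \<in> e ` D" "h q \<in> h ` D" using qr by blast+
          then have "e q \<in> insert n (h ` D) \<inter> e ` D" using eh by simp
          then show ?thesis by blast
        next
          assume eh: "e r = h r"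
          have "e r \<in> e ` D" "h r \<in> h ` D" using qr by blast+
          then have "e r \<in> insert n (h ` D) \<inter> e ` D" using eh by simp
          then show ?thesis by blast
        qed
        then show ?thesis by (intro bexI[OF _ h(2)] bexI[OF _ eD] impI)
      qed (use X D DN(2) in auto)
    qed
  qed
qed

text \<open>The set is \<open>insert z X0\<close>; replacing \<open>z\<close> by \<open>n\<close>
  keeps \<open>X0\<close>, which is not empty because \<open>u \<ge> 2\<close>.\<close>

lemma inserted_to_n:
  assumes X: "X \<in> min_gen_mod G L u" "X \<notin> min_gen_mod G N u" and u: "u \<ge> 2"
    and n: "n \<in> N" "n \<notin> L" and x: "x \<in> X"
  shows "(x, n) \<in> (link G L u)\<^sup>*"
proof -
  obtain X0 z K where X0: "X = insert z X0" "X0 \<in> min_gen_mod G N (u - 1)" "K \<in> supps" "X0 \<subseteq> K"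
    by (rule min_gen_mod_cases[OF X]) (rule that)
  have "card X0 \<noteq> 0" using min_gen_modD(3)[OF X0(2)] u by simp
  then obtain w where w: "w \<in> X0" by fastforce
  have "insert n X0 \<in> min_gen_mod G L u"
    using min_gen_mod_insert[OF X0(2-4) n] u by simp
  then have "(w, n) \<in> (link G L u)\<^sup>*" by (rule min_gen_mod_link) (use w in auto)
  moreover have "(x, w) \<in> (link G L u)\<^sup>*" using X0(1) w x by (intro min_gen_mod_link[OF X(1)]) auto
  ultimately show ?thesis by simp
qed

text \<open>With \<open>w\<close> in \<open>K\<close> generating modulo \<open>N\<close> and
  \<open>v\<close> in \<open>X\<close> outside \<open>K\<close>, the pair \<open>{v, w}\<close>
  joins \<open>X\<close> to \<open>{w, n}\<close>. The pair is minimal because \<open>w\<close> lies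
  in \<open>K\<close> and \<open>{v}\<close> is a proper subset of the minimal set
  \<open>X\<close>.\<close>

lemma lifted_to_n_2:
  assumes X: "X \<in> min_gen_mod G L 2" "X \<in> min_gen_mod G N 2"
    and Y: "Y \<in> min_gen_mod G N 1" and K: "K \<in> supps"
    and n: "n \<in> N" "n \<notin> L" and x: "x \<in> X"
  shows "(x, n) \<in> (link G L 2)\<^sup>*"
proof -
  obtain f where f: "f ` Y \<subseteq> K" "f ` Y \<in> min_gen_mod G N 1" using lift_to_supp[OF K Y] by metis
  obtain w where w: "f ` Y = {w}" using min_gen_modD(3)[OF f(2)] card_1_singletonE by metis
  note gw = min_gen_modD(1)[OF f(2), unfolded w]
  have wK: "w \<in> K" using f w by auto
  have "\<not> X \<subseteq> K" using not_gen_modI[of K X L] suppsD[OF K] min_gen_modD(1)[OF X(1)] by blast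
  then obtain v where v: "v \<in> X" "v \<notin> K" by blast
  have vc: "v \<in> carrier G" using v min_gen_modD(2)[OF X(1)] by blast
  have "gen_mod G L {v, w}"
    using gen_mod_insert_supp[OF gw K _ vc v(2)] wK by simp
  moreover have "\<not> gen_mod G L Z" if Z: "Z \<subset> {v, w}" for Z
  proof
    assume gZ: "gen_mod G L Z"
    have "\<not> Z \<subseteq> K" using not_gen_modI[of K Z L] suppsD[OF K] gZ by blast
    then have "Z = {v}" using Z wK by blast
    moreover have "{v} \<subset> X"
    proof -
      have "X \<noteq> {v}" using min_gen_modD(3)[OF X(1)] by auto
      then show ?thesis using v by blast
    qed
    ultimately show False using min_gen_modD(4)[OF X(1)] gZ by blast
  qed
  moreover have "v \<noteq> w" using v wK by blast
  ultimately have "{v, w} \<in> min_gen_mod G L 2" by (simp add: min_gen_mod_def)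
  then have "(v, w) \<in> (link G L 2)\<^sup>*" by (rule min_gen_mod_link) auto
  moreover have "insert n {w} \<in> min_gen_mod G L 2"
    using min_gen_mod_insert[OF f(2) K f(1) n] w by (simp add: numeral_2_eq_2)
  then have "(w, n) \<in> (link G L 2)\<^sup>*" by (rule min_gen_mod_link) auto
  moreover have "(x, v) \<in> (link G L 2)\<^sup>*" by (rule min_gen_mod_link[OF X(1) x v(1)])
  ultimately show ?thesis by simp
qed

text \<open>\<open>adjacent_sizes\<close> gives \<open>V\<close> of size \<open>u\<close> and
  \<open>W\<close> of size \<open>u - 1\<close> with a common element \<open>z\<close>. Lifting
  \<open>W\<close> into \<open>K\<close> and adding \<open>n\<close> yields a set of size
  \<open>u\<close> that is minimal modulo \<open>L\<close>; its element \<open>g z\<close> also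
  belongs to a generating lift of \<open>V\<close>, which \<open>chain_lift\<close> reaches from
  \<open>x\<close>.\<close>

lemma lifted_to_n_3:
  assumes u: "u \<ge> 3" and conn: "link_connected G N u" and sizes: "adjacent_sizes G N"
    and X: "X \<in> min_gen_mod G L u" "X \<in> min_gen_mod G N u"
    and Y: "Y \<in> min_gen_mod G N (u - 1)" and K: "K \<in> supps"
    and n: "n \<in> N" "n \<notin> L" and x: "x \<in> X"
  shows "(x, n) \<in> (link G L u)\<^sup>*"
proof -
  have "\<exists>X\<in>min_gen_mod G N u. \<exists>Y\<in>min_gen_mod G N (u - 1). 3 \<le> u \<longrightarrow> X \<inter> Y \<noteq> {}"
    using sizes[unfolded adjacent_sizes_def, rule_format, of "u - 1" u] u X(2) Y by auto
  then obtain V W z where V: "V \<in> min_gen_mod G N u" and W: "W \<in> min_gen_mod G N (u - 1)"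
    and z: "z \<in> V" "z \<in> W" using u by blast
  obtain g where g: "\<forall>x\<in>W. g x \<in> N #> x" "g ` W \<subseteq> K" "g ` W \<in> min_gen_mod G N (u - 1)"
    using lift_to_supp[OF K W] by blast
  have gz: "g z \<in> carrier G" "N #> g z = N #> z"
    using lift_simps[OF min_gen_modD(2)[OF W] z(2)] g(1) z(2) by auto
  have fi: "finite V" "finite W" using finite_min_gen_mod V W by auto
  have c: "card (V - {z}) = u - 1" "card (W - {z}) = u - 2"
    using fi z min_gen_modD(3)[OF V] min_gen_modD(3)[OF W] by auto
  let ?s = "card {K \<in> supps. {g z} \<subseteq> K}"
  have cards: "card L < card N" "0 < card N"
    using psubset_card_mono[OF finite_subset[OF N.subset fin] less] by auto
  note gW = gen_mod_replace[OF W z(2) gz] and gV = gen_mod_replace[OF V z(1) gz]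
  \<comment> \<open>The bound for the \<open>u - 2\<close> remaining elements of \<open>W\<close>
    becomes strict for the \<open>u - 1\<close> remaining elements of \<open>V\<close>, because
    \<open>card L < card N\<close>; so \<open>g z\<close> extends to a generating lift of
    \<open>V\<close>.\<close>
  have "?s * card L ^ (u - 2) \<le> card N ^ (u - 2)"
    using lift_count(2)[OF _ gen_modD[OF gW] gW] fi c by simp
  then have "?s * card L ^ (u - 2) * card L \<le> card N ^ (u - 2) * card L" by (rule mult_le_mono1)
  also have "\<dots> < card N ^ (u - 2) * card N" using cards by simp
  finally have "?s * card L ^ (u - 1) < card N ^ (u - 1)"
    using u by (simp add: power_eq_if mult_ac numeral_2_eq_2 Suc_diff_Suc flip: power_Suc)
  then have "\<exists>f. (\<forall>x\<in>V - {z}. f x \<in> N #> x) \<and> gen_mod G L ({g z} \<union> f ` (V - {z}))"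
    using lift_count(1)[OF _ gen_modD[OF gV] gV] fi c by simp
  then obtain f where f: "\<forall>x\<in>V - {z}. f x \<in> N #> x" "gen_mod G L ({g z} \<union> f ` (V - {z}))" by blast
  define h where "h = f(z := g z)"
  have "{g z} \<union> f ` (V - {z}) = h ` V" using z by (auto simp: h_def)
  then have hV: "gen_mod G L (h ` V)" using f(2) by simp
  have hl: "\<forall>x\<in>V. h x \<in> N #> x" using f(1) g(1) z by (auto simp: h_def)
  have path: "(x, z) \<in> (link G N u)\<^sup>*"
    using conn[unfolded link_connected_def, rule_format, OF X(2) V x z(1)] .
  have "(x, h z) \<in> (link G L u)\<^sup>*"
    by (rule chain_lift[OF _ X(2) min_gen_modD(1)[OF X(1)] x path V z(1) refl hl hV z(1)])
      (rule same_lifts_3[OF _ u], assumption+)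
  moreover have "insert n (g ` W) \<in> min_gen_mod G L u"
    using min_gen_mod_insert[OF g(3) K g(2) n] u by simp
  then have "(g z, n) \<in> (link G L u)\<^sup>*" by (rule min_gen_mod_link) (use z in auto)
  ultimately show ?thesis by (simp add: h_def)
qed

text \<open>If some minimal set modulo \<open>L\<close> is not minimal modulo \<open>N\<close>, all
  elements of all such sets are linked to one \<open>n\<close> in \<open>N - L\<close>. Otherwise
  \<open>chain_lift\<close> lifts the paths modulo \<open>N\<close>.\<close>

lemma link_connected_step:
  assumes u: "u \<ge> 2" and conn: "link_connected G N u" and sizes: "adjacent_sizes G N"
  shows "link_connected G L u"
proof (cases "min_gen_mod G L u \<subseteq> min_gen_mod G N u")
  case False
  then obtain X where X: "X \<in> min_gen_mod G L u" "X \<notin> min_gen_mod G N u" by blast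
  obtain X0 K where X0: "X0 \<in> min_gen_mod G N (u - 1)" "K \<in> supps"
    using min_gen_mod_cases[OF X] by blast
  obtain n where n: "n \<in> N" "n \<notin> L" using less by blast
  have "(y, n) \<in> (link G L u)\<^sup>*" if Y: "Y \<in> min_gen_mod G L u" and y: "y \<in> Y" for Y y
  proof (cases "Y \<in> min_gen_mod G N u")
    case True
    show ?thesis
    proof (cases "u = 2")
      case u2: True
      then show ?thesis using lifted_to_n_2[of Y X0 K n y] Y True X0 n y by simp
    next
      case False
      then show ?thesis using lifted_to_n_3[OF _ conn sizes Y True X0 n y] u by simp
    qed
  qed (use inserted_to_n[OF Y _ u n y] in blast)
  then show ?thesis
    unfolding link_connected_def using link_rtrancl_sym rtrancl_trans by metis
next
  case True
  \<comment> \<open>If both existed, adding \<open>n\<close> to a lift inside \<open>K\<close> would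
    give a set of size \<open>u\<close> that is minimal modulo \<open>L\<close> but not modulo
    \<open>N\<close>. For \<open>u = 2\<close> this prepares the use of
    \<open>same_lifts_2\<close>.\<close>
  have no: "supps = {} \<or> min_gen_mod G N (u - 1) = {}"
  proof (rule ccontr)
    assume "\<not> ?thesis"
    then obtain K Z where K: "K \<in> supps" and Z: "Z \<in> min_gen_mod G N (u - 1)" by blast
    obtain f where f: "f ` Z \<subseteq> K" "f ` Z \<in> min_gen_mod G N (u - 1)" using lift_to_supp[OF K Z] by metis
    obtain n where n: "n \<in> N" "n \<notin> L" using less by blast
    have "insert n (f ` Z) \<in> min_gen_mod G L u"
      using min_gen_mod_insert[OF f(2) K f(1) n] u by simp
    then have "insert n (f ` Z) \<in> min_gen_mod G N u" using True by blast
    moreover have "n \<notin> f ` Z" using supps_inter[OF K] n f(1) by blast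
    ultimately show False
      using min_gen_modD(4)[of "insert n (f ` Z)" G N u "f ` Z"] min_gen_modD(1)[OF f(2)] by blast
  qed
  have same: "(f x, g y) \<in> (link G L u)\<^sup>*"
    if "X \<in> min_gen_mod G N u" "\<forall>x\<in>X. f x \<in> N #> x" "\<forall>x\<in>X. g x \<in> N #> x"
      "gen_mod G L (f ` X)" "gen_mod G L (g ` X)" "x \<in> X" "y \<in> X" for X f g x y
  proof (cases "u \<ge> 3")
    case True
    show ?thesis by (rule same_lifts_3[OF that(1) True that(2,4,3,5-7)])
  next
    case False
    then have u2: "u = 2" using u by simp
    show ?thesis
    proof (cases "supps = {}")
      case True
      show ?thesis by (rule same_lifts_no_supps[OF that(1) u True that(2,3,6,7)])
    next
      case False
      then have "min_gen_mod G N 1 = {}" using no u2 by simp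
      then show ?thesis using same_lifts_2[of X f g x y] that u2 by simp
    qed
  qed
  show ?thesis
    unfolding link_connected_def
  proof (intro ballI)
    fix X Y x y assume X: "X \<in> min_gen_mod G L u" and Y: "Y \<in> min_gen_mod G L u" and xy: "x \<in> X" "y \<in> Y"
    have XN: "X \<in> min_gen_mod G N u" and YN: "Y \<in> min_gen_mod G N u" using X Y True by auto
    have path: "(x, y) \<in> (link G N u)\<^sup>*"
      using conn[unfolded link_connected_def, rule_format, OF XN YN xy] .
    have id: "\<forall>x\<in>Y. id x \<in> N #> x" "gen_mod G L (id ` Y)"
      using rcos_self[OF _ N.subgroup_axioms] min_gen_modD(1,2)[OF Y] by auto
    have "(x, id y) \<in> (link G L u)\<^sup>*"
      by (rule chain_lift[OF _ XN min_gen_modD(1)[OF X] xy(1) path YN xy(2) refl id xy(2)])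
        (rule same, assumption+)
    then show "(x, y) \<in> (link G L u)\<^sup>*" by simp
  qed
qed

end

section \<open>Abelian chief factors of soluble groups, and the induction\<close>

context group
begin

text \<open>The last term \<open>D\<close> of the derived series not inside \<open>L\<close> has its
  derived subgroup in \<open>L\<close>, so \<open>M = L D\<close> is normal and \<open>M / L\<close>
  is abelian. \<open>N\<close> is a smallest normal subgroup strictly above \<open>L\<close> and
  inside \<open>M\<close>.\<close>

lemma exists_chief_factor:
  assumes fin: "finite (carrier G)" and sol: "solvable G" and L: "L \<lhd> G" and ne: "L \<noteq> carrier G"
  shows "\<exists>N. chief_factor G L N"
proof -
  interpret L: normal L G by (rule L)
  let ?D = "\<lambda>k. (derived G ^^ k) (carrier G)"
  have Dn: "?D k \<lhd> G" for k by (induction k) (auto intro: normal_self derived_is_normal)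
  obtain m where "?D m = {\<one>}" using sol solvable_iff_trivial_derived_seq by blast
  then have "?D m \<subseteq> L" using subgroup.one_closed[OF L.subgroup_axioms] by simp
  then have ex: "\<exists>k. ?D k \<subseteq> L" ..
  define k where "k = (LEAST k. ?D k \<subseteq> L)"
  have k: "?D k \<subseteq> L" unfolding k_def using ex by (rule LeastI_ex)
  have "k \<noteq> 0" using k ne L.subset by auto
  then obtain j where j: "k = Suc j" using not0_implies_Suc by blast
  have jL: "\<not> ?D j \<subseteq> L" using not_less_Least[of j "\<lambda>k. ?D k \<subseteq> L"] j by (simp add: k_def)
  define D where "D = ?D j"
  interpret D: normal D G unfolding D_def by (rule Dn)
  have DL: "a \<otimes> b \<otimes> inv a \<otimes> inv b \<in> L" if "a \<in> D" "b \<in> D" for a b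
  proof -
    have "a \<otimes> b \<otimes> inv a \<otimes> inv b \<in> derived G D"
      unfolding derived_def using that by (intro generate.incl) blast
    then show ?thesis using k j by (auto simp: D_def)
  qed
  define M where "M = {g \<in> carrier G. \<exists>d\<in>D. L #> d = L #> g}"
  have Mcomm: "L #> (a \<otimes> b) = L #> (b \<otimes> a)" if a: "a \<in> M" and b: "b \<in> M" for a b
  proof -
    obtain d e where de: "d \<in> D" "e \<in> D" "L #> d = L #> a" "L #> e = L #> b"
      using a b by (auto simp: M_def)
    have c: "a \<in> carrier G" "b \<in> carrier G" "d \<in> carrier G" "e \<in> carrier G"
      using a b de D.subset by (auto simp: M_def)
    have "L #> (a \<otimes> b) = L #> (d \<otimes> e)" using c de by (intro L.rcos_mult_cong) auto
    also have "\<dots> = L #> (e \<otimes> d)"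
      using L.rcos_eq_iff[of "d \<otimes> e" "e \<otimes> d"] DL[OF de(1,2)] c by (simp add: inv_mult_group m_assoc)
    also have "\<dots> = L #> (b \<otimes> a)" using c de by (intro L.rcos_mult_cong) auto
    finally show ?thesis .
  qed
  have Msub: "subgroup M G" unfolding M_def by (rule L.subgroup_mod[OF D.subgroup_axioms])
  have "x \<otimes> h \<otimes> inv x \<in> M" if x: "x \<in> carrier G" and h: "h \<in> M" for x h
  proof -
    obtain d where d: "d \<in> D" "L #> d = L #> h" using h by (auto simp: M_def)
    have c: "h \<in> carrier G" "d \<in> carrier G" using h d D.subset by (auto simp: M_def)
    have "L #> (x \<otimes> d \<otimes> inv x) = L #> (x \<otimes> h \<otimes> inv x)"
      using c x d by (intro L.rcos_mult_cong) auto
    then show ?thesis using D.inv_op_closed2[OF x d(1)] x c unfolding M_def by auto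
  qed
  then have Mn: "M \<lhd> G" using Msub normal_inv_iff by blast
  have LM: "L \<subset> M"
  proof
    show "L \<subseteq> M"
    proof
      fix l assume l: "l \<in> L"
      have "L #> \<one> = L #> l"
        using L.rcos_const[OF is_group l] coset_mult_one[OF L.subset] by simp
      moreover have "\<one> \<in> D" by (rule subgroup.one_closed[OF D.subgroup_axioms])
      ultimately show "l \<in> M" using l L.subset unfolding M_def by blast
    qed
    have "D \<subseteq> M" using D.subset by (auto simp: M_def)
    then show "L \<noteq> M" using jL by (auto simp: D_def)
  qed
  define P where "P N \<longleftrightarrow> N \<lhd> G \<and> L \<subset> N \<and> N \<subseteq> M" for N
  have "P M" using Mn LM by (simp add: P_def)
  then obtain N where N: "P N" "\<And>Q. P Q \<Longrightarrow> card N \<le> card Q"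
    using ex_has_least_nat[of P M card] by blast
  interpret N: normal N G using N(1) by (simp add: P_def)
  have "chief_factor G L N"
  proof unfold_locales
    show "finite (carrier G)" by (rule fin)
    show "L \<subset> N" using N(1) by (simp add: P_def)
    show "L #> (a \<otimes> b) = L #> (b \<otimes> a)" if "a \<in> N" "b \<in> N" for a b
      using Mcomm that N(1) by (auto simp: P_def)
    show "Q = L \<or> Q = N" if Q: "Q \<lhd> G" "L \<subseteq> Q" "Q \<subseteq> N" for Q
    proof (rule ccontr)
      assume *: "\<not> (Q = L \<or> Q = N)"
      then have "P Q" using Q N(1) by (auto simp: P_def)
      then have "card N \<le> card Q" by (rule N(2))
      moreover have "finite N" using fin N.subset finite_subset by blast
      ultimately have "Q = N" using card_seteq[OF _ Q(3)] by blast
      then show False using * by blast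
    qed
  qed
  then show ?thesis by blast
qed

lemma min_gen_mod_carrier:
  assumes "X \<in> min_gen_mod G (carrier G) u"
  shows "X = {}"
proof (rule ccontr)
  assume "X \<noteq> {}"
  then have "\<not> gen_mod G (carrier G) {}" using min_gen_modD(4)[OF assms, of "{}"] by blast
  moreover have "gen_mod G (carrier G) {}" by (rule gen_modI) (auto dest: subgroup.subset)
  ultimately show False by blast
qed

text \<open>The induction descends from \<open>L = carrier G\<close>, where only the empty set is
  minimal and both properties hold vacuously.\<close>

lemma link_connected_normal:
  assumes fin: "finite (carrier G)" and sol: "solvable G" and L: "L \<lhd> G" and u: "u \<ge> 2"
  shows "adjacent_sizes G L \<and> link_connected G L u"
  using L
proof (induction "card (carrier G) - card L" arbitrary: L rule: less_induct)
  case less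
  show ?case
  proof (cases "L = carrier G")
    case True
    have "X = {} \<and> v = 0" if "X \<in> min_gen_mod G L v" for X v
    proof -
      have "X = {}" using min_gen_mod_carrier that True by blast
      then show ?thesis using min_gen_modD(3)[OF that] by simp
    qed
    then show ?thesis unfolding adjacent_sizes_def link_connected_def by fastforce
  next
    case False
    then obtain N where "chief_factor G L N" using exists_chief_factor[OF fin sol less.prems] by blast
    then interpret chief_factor G L N .
    have "card L < card N"
      using chief_factor.less N.subset fin by (meson \<open>chief_factor G L N\<close> finite_subset psubset_card_mono)
    moreover have "card N \<le> card (carrier G)" using fin N.subset by (rule card_mono)
    ultimately have "adjacent_sizes G N \<and> link_connected G N u"
      by (intro less.hyps N.normal_axioms) linarith
    then show ?thesis using adjacent_sizes_step link_connected_step[OF u] by blast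
  qed
qed

section \<open>The trivial subgroup and the translation to the graph\<close>

lemma gen_mod_one_iff: "gen_mod G {\<one>} X \<longleftrightarrow> X \<subseteq> carrier G \<and> generate G X = carrier G"
proof -
  have "generate G (X \<union> {\<one>}) = generate G X" if "X \<subseteq> carrier G"
  proof
    show "generate G (X \<union> {\<one>}) \<subseteq> generate G X"
      using generate.incl[of _ X G] generate.one[of G X]
      by (intro generate_subgroup_incl generate_is_subgroup[OF that]) auto
    show "generate G X \<subseteq> generate G (X \<union> {\<one>})" by (rule mono_generate) blast
  qed
  then show ?thesis by (auto simp: gen_mod_def)
qed

end

lemma (in group) min_gen_mod_one:
  "min_gen_mod G {\<one>} u = {X. minimal_generating_set G X \<and> card X = u}"
  unfolding min_gen_mod_def minimal_generating_set_def generates_def gen_mod_one_iff by blast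

theorem theorem2:
  fixes G :: "('a, 'b) monoid_scheme" and u :: nat
  assumes "group G" and "finite (carrier G)" and "solvable G" and "u > 0"
  shows "connected_or_null (gen_Delta u G)"
proof -
  interpret group G by (rule assms(1))
  let ?M = "min_gen_mod G {\<one>\<^bsub>G\<^esub>} u"
  \<comment> \<open>\<open>connected\<close> means strong connectedness of the symmetric closure, so
    paths are built in \<open>?S\<close>.\<close>
  let ?S = "mk_symmetric (gen_Delta u G)"
  have arc: "(x, y) \<in> parcs (gen_Gamma u G) \<longleftrightarrow> x \<noteq> y \<and> (\<exists>X\<in>?M. x \<in> X \<and> y \<in> X)" for x y
    unfolding gen_Gamma_def min_gen_mod_one
    by (auto simp: minimal_generating_set_def generates_def)
  have nonisol: "x \<in> nonisolated (with_proj (gen_Gamma u G)) \<longleftrightarrow> (\<exists>y. (x, y) \<in> parcs (gen_Gamma u G))" for x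
    by (auto simp: nonisolated_def gen_Gamma_def)
  have verts: "x \<in> verts (gen_Delta u G) \<longleftrightarrow> (\<exists>y. x \<noteq> y \<and> (\<exists>X\<in>?M. x \<in> X \<and> y \<in> X))" for x
    unfolding gen_Delta_def by (simp add: nonisol arc)
  have pverts: "pverts ?S = verts (gen_Delta u G)" by (simp add: mk_symmetric_def)
  have parcs: "(x, y) \<in> parcs ?S" if xy: "(x, y) \<in> parcs (gen_Gamma u G)" for x y
  proof -
    have "(y, x) \<in> parcs (gen_Gamma u G)" using xy arc by blast
    then have "(x, y) \<in> arcs (gen_Delta u G)"
      using xy by (auto simp: gen_Delta_def nonisol)
    then show ?thesis by (force simp: mk_symmetric_def gen_Delta_def)
  qed
  show ?thesis
  proof (cases "u = 1")
    case True
    \<comment> \<open>An edge needs two distinct elements of one set, so for \<open>u = 1\<close>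
      the graph has no vertices.\<close>
    have "x = y" if "X \<in> ?M" "x \<in> X" "y \<in> X" for X x y
      using min_gen_modD(3)[OF that(1)] True that(2,3) by (metis card_1_singletonE singletonD)
    then have "verts (gen_Delta u G) = {}" using verts by blast
    then show ?thesis by (simp add: connected_or_null_def)
  next
    case False
    then have conn: "link_connected G {\<one>\<^bsub>G\<^esub>} u"
      using link_connected_normal[OF assms(2,3) one_is_normal, of u] assms(4) by simp
    have reach: "(x, y) \<in> rtrancl_on (pverts ?S) (parcs ?S)"
      if "(x, y) \<in> (link G {\<one>\<^bsub>G\<^esub>} u)\<^sup>*" and x: "x \<in> pverts ?S" for x y
      using that(1)
    proof (induction rule: rtrancl_induct)
      case base
      show ?case using x by simp
    next
      case (step y z)
      show ?case
      proof (cases "y = z")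
        case True
        then show ?thesis using step.IH by simp
      next
        case False
        \<comment> \<open>Congruence modulo the trivial subgroup is equality, so a step of
          \<open>link\<close> between distinct elements is an edge.\<close>
        have "{\<one>\<^bsub>G\<^esub>} #>\<^bsub>G\<^esub> w = {w}" if "w \<in> carrier G" for w using that by (simp add: r_coset_def)
        then have yz: "(y, z) \<in> parcs (gen_Gamma u G)"
          using step.hyps(2) False by (auto simp: link_def arc)
        then obtain X where "X \<in> ?M" "z \<in> X" "y \<in> X" "z \<noteq> y" unfolding arc by blast
        then have "z \<in> pverts ?S" unfolding pverts verts by blast
        then show ?thesis by (rule rtrancl_on_into_rtrancl_on[OF step.IH parcs[OF yz]])
      qed
    qed
    have "(x, y) \<in> rtrancl_on (pverts ?S) (parcs ?S)" if xy: "x \<in> pverts ?S" "y \<in> pverts ?S" for x y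
    proof -
      obtain X Y where "X \<in> ?M" "x \<in> X" "Y \<in> ?M" "y \<in> Y" using xy unfolding pverts verts by blast
      then have "(x, y) \<in> (link G {\<one>\<^bsub>G\<^esub>} u)\<^sup>*" using conn unfolding link_connected_def by blast
      then show ?thesis using reach xy(1) by blast
    qed
    then show ?thesis
      unfolding connected_or_null_def connected_def strongly_connected_def reachable_def
      using pverts by auto
  qed
qed

end
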